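(* Let $\mathcal{G}$ be a finite metric graph with two cycles whose ratio of lengths is Diophantine and with two non-adjacent vertices $x,y$. Let $\mathcal{G}'$ be the graph obtained from $\mathcal{G}$ by attaching an edge $e$ of length $l$ between $x,y$. Let $h$ and $h'$ be the volume entropy of $\mathcal{G}$ and $\mathcal{G}'$, respectively. Then $$h'=h+Ce^{-hl}+O\big(e^{-(1+\gamma)hl}\big)\qquad\text{as } l\to\infty$$ for some constant $C>0$ and any $\gamma<1$.
   Context: A finite metric graph $\mathcal{G}$ has a finite vertex set $V\mathcal{G}$ and a finite set of oriented edges; each oriented edge $e$ has a reverse edge $\overline{e}$, and $e,\overline e$ have the same positive length. A path is a concatenation of adjacent edges with consistent orientation, starting and ending at vertices; its length is the sum of the lengths of its edges; it is without backtracking if no edge $e$ in it is immediately followed by $\overline{e}$. A cycle is a path without backtracking whose initial and terminal vertices coincide. A real number $s$ is Diophantine if there exist $\alpha,\beta>0$ such that $|s-\frac pq|\ge\alpha q^{-\beta}$ for all $p,q\in\mathbb{Z}$ with $q>0$. The volume entropy of a finite metric graph $\mathcal{G}$ is $\max_{z\in V\mathcal{G}}\lim_{r\to\infty}\frac{\log \mathrm{vol}\,B(\tilde z,r)}{r}$, where $\tilde z$ is a lift of $z$ to the universal cover $\widetilde{\mathcal{G}}$ and $\mathrm{vol}\,B(\tilde z,r)$ is the total length of the edges (or parts of edges) contained in the metric ball of center $\tilde z$ and radius $r$ in $\widetilde{\mathcal{G}}$.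
   Formalization: The graph is assumed connected, as the universal cover requires; without this the claim fails, e.g. when x and y lie in a component that is a path while another component has positive volume entropy, so that h' = h. *)

theory Defs
  imports
    "HOL-Analysis.Analysis"
    "HOL-Library.Landau_Symbols"
    "Graph_Theory.Bidirected_Digraph"
    "Graph_Theory.Digraph_Component"
    "Graph_Theory.Shortest_Path"
begin

section \<open>Metric graphs\<close>

text \<open>
  Loops and multiple edges are allowed. As \<open>arev\<close> is fixed point free on arcs, every geometric
  edge is a pair of distinct arcs \<open>a\<close>, \<open>arev a\<close>. Off the arcs, \<open>arev\<close> is the identity, as
  \<open>bidirected_digraph\<close> requires. The graph may be infinite, since universal covers are instances too.
\<close>

locale metric_graph = bidirected_digraph G arev
  for G :: "('v, 'e) pre_digraph" and arev :: "'e \<Rightarrow> 'e" +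
  fixes len :: "'e \<Rightarrow> real"
  assumes len_pos: "a \<in> arcs G \<Longrightarrow> len a > 0"
    and len_arev: "a \<in> arcs G \<Longrightarrow> len (arev a) = len a"

locale finite_metric_graph = metric_graph G arev len + fin_digraph G
  for G :: "('v, 'e) pre_digraph" and arev :: "'e \<Rightarrow> 'e" and len :: "'e \<Rightarrow> real"

definition no_backtracking :: "('e \<Rightarrow> 'e) \<Rightarrow> 'e awalk \<Rightarrow> bool" where
  "no_backtracking arev p \<longleftrightarrow> successively (\<lambda>a b. b \<noteq> arev a) p"

text \<open>
  Backtracking is only excluded inside the path: the last arc may be the reverse of the first one.
\<close>

definition is_cycle :: "('v, 'e) pre_digraph \<Rightarrow> ('e \<Rightarrow> 'e) \<Rightarrow> 'e awalk \<Rightarrow> bool" where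
  "is_cycle G arev p \<longleftrightarrow>
     p \<noteq> [] \<and> no_backtracking arev p \<and> (\<exists>u. pre_digraph.awalk G u p u)"

definition path_length :: "('e \<Rightarrow> real) \<Rightarrow> 'e awalk \<Rightarrow> real" where
  "path_length len p = sum_list (map len p)"

definition diophantine :: "real \<Rightarrow> bool" where
  "diophantine s \<longleftrightarrow> (\<exists>\<alpha>>0. \<exists>\<beta>>0. \<forall>p q :: int. q > 0 \<longrightarrow>
     \<bar>s - of_int p / of_int q\<bar> \<ge> \<alpha> * of_int q powr (- \<beta>))"


section \<open>The universal cover\<close>

text \<open>
  The universal cover with base point \<open>z\<close>: its vertices are the paths without backtracking that
  start at \<open>z\<close>, and the arc \<open>(p, a)\<close> is the lift of \<open>a\<close> that starts at \<open>p\<close>. It ends at \<open>p @ [a]\<close>,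
  reduced if necessary. The vertex \<open>[]\<close> is a lift of \<open>z\<close>.
\<close>

definition reduced_snoc :: "('e \<Rightarrow> 'e) \<Rightarrow> 'e awalk \<Rightarrow> 'e \<Rightarrow> 'e awalk" where
  "reduced_snoc arev p a = (if p \<noteq> [] \<and> a = arev (last p) then butlast p else p @ [a])"

definition universal_cover ::
  "('v, 'e) pre_digraph \<Rightarrow> ('e \<Rightarrow> 'e) \<Rightarrow> 'v \<Rightarrow> ('e awalk, 'e awalk \<times> 'e) pre_digraph" where
  "universal_cover G arev z =
    \<lparr> verts = {p. no_backtracking arev p \<and> (\<exists>u. pre_digraph.awalk G z p u)},
      arcs = {(p, a). no_backtracking arev p \<and> a \<in> arcs G \<and> pre_digraph.awalk G z p (tail G a)},
      tail = fst,
      head = (\<lambda>(p, a). reduced_snoc arev p a) \<rparr>"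

definition cover_arev ::
  "('v, 'e) pre_digraph \<Rightarrow> ('e \<Rightarrow> 'e) \<Rightarrow> 'v \<Rightarrow> 'e awalk \<times> 'e \<Rightarrow> 'e awalk \<times> 'e" where
  "cover_arev G arev z = (\<lambda>(p, a).
     if (p, a) \<in> arcs (universal_cover G arev z) then (reduced_snoc arev p a, arev a) else (p, a))"

definition cover_len :: "('e \<Rightarrow> real) \<Rightarrow> 'e awalk \<times> 'e \<Rightarrow> real" where
  "cover_len len = (\<lambda>(p, a). len a)"

lemma (in metric_graph) awalk_reduced_snoc:
  assumes "no_backtracking arev p" "awalk z p (tail G a)" "a \<in> arcs G"
  shows "no_backtracking arev (reduced_snoc arev p a)"
    and "awalk z (reduced_snoc arev p a) (head G a)"
    and "reduced_snoc arev (reduced_snoc arev p a) (arev a) = p"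
    and "reduced_snoc arev p a \<noteq> p"
proof -
  have *: "no_backtracking arev (reduced_snoc arev p a) \<and> awalk z (reduced_snoc arev p a) (head G a)
    \<and> reduced_snoc arev (reduced_snoc arev p a) (arev a) = p \<and> reduced_snoc arev p a \<noteq> p"
  proof (cases p rule: rev_cases)
    case Nil
    with assms show ?thesis
      by (auto simp: no_backtracking_def reduced_snoc_def awalk_Nil_iff awalk_simps)
  next
    case (snoc q b)
    have q: "awalk z q (tail G b)" and b: "b \<in> arcs G" "head G b = tail G a"
      using assms(2) unfolding snoc by (auto simp: awalk_simps)
    show ?thesis
    proof (cases "a = arev b")
      case True
      with assms(1) snoc q b show ?thesis
        by (auto simp: no_backtracking_def reduced_snoc_def successively_append_iff)
    next
      case False
      with assms snoc q b show ?thesis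
        by (auto simp: no_backtracking_def reduced_snoc_def successively_append_iff awalk_simps
              butlast_append)
    qed
  qed
  then show "no_backtracking arev (reduced_snoc arev p a)"
    and "awalk z (reduced_snoc arev p a) (head G a)"
    and "reduced_snoc arev (reduced_snoc arev p a) (arev a) = p"
    and "reduced_snoc arev p a \<noteq> p" by auto
qed

lemma metric_graph_universal_cover:
  assumes "metric_graph G arev len"
  shows "metric_graph (universal_cover G arev z) (cover_arev G arev z) (cover_len len)"
proof -
  interpret metric_graph G arev len by fact
  show ?thesis
  proof unfold_locales
    fix e assume "e \<in> arcs (universal_cover G arev z)"
    then obtain p a where e: "e = (p, a)"
      and *: "no_backtracking arev p" "awalk z p (tail G a)" "a \<in> arcs G"
      by (auto simp: universal_cover_def)
    note ** = * awalk_reduced_snoc[OF *]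
    have in_cover: "(p, a) \<in> arcs (universal_cover G arev z)"
      "(reduced_snoc arev p a, arev a) \<in> arcs (universal_cover G arev z)"
      using ** by (auto simp: universal_cover_def)
    show "tail (universal_cover G arev z) e \<in> verts (universal_cover G arev z)"
      "head (universal_cover G arev z) e \<in> verts (universal_cover G arev z)"
      using ** by (auto simp: universal_cover_def e)
    show "cover_arev G arev z (cover_arev G arev z e) = e"
      using ** in_cover by (simp add: cover_arev_def e)
    show "tail (universal_cover G arev z) (cover_arev G arev z e)
        = head (universal_cover G arev z) e"
      using in_cover by (simp add: cover_arev_def e universal_cover_def)
    show "cover_len len e > 0" "cover_len len (cover_arev G arev z e) = cover_len len e"
      using in_cover * len_pos len_arev by (auto simp: cover_len_def cover_arev_def e)
  next
    fix e
    show "e \<in> arcs (universal_cover G arev z) \<longleftrightarrow> cover_arev G arev z e \<noteq> e"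
    proof (cases e)
      case (Pair p a)
      have "reduced_snoc arev p a \<noteq> p" if "e \<in> arcs (universal_cover G arev z)"
        using that awalk_reduced_snoc(4)[of p z a] by (auto simp: universal_cover_def Pair)
      then show ?thesis by (auto simp: cover_arev_def Pair)
    qed
  qed
qed


section \<open>Volume entropy\<close>

text \<open>
  Distance from the vertex \<open>v\<close> to the point of the arc \<open>a\<close> at distance \<open>t\<close> from its tail,
  for \<open>0 \<le> t \<le> len a\<close>.
\<close>

definition dist_on_arc ::
  "('v, 'e) pre_digraph \<Rightarrow> ('e \<Rightarrow> real) \<Rightarrow> 'v \<Rightarrow> 'e \<Rightarrow> real \<Rightarrow> ereal" where
  "dist_on_arc G len v a t =
     min (wf_digraph.\<mu> G len v (tail G a) + ereal t)
         (wf_digraph.\<mu> G len v (head G a) + ereal (len a - t))"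

text \<open>
  Total length of the parts of edges in the ball. The division by 2 is there because every edge
  is counted twice, as \<open>a\<close> and as \<open>arev a\<close>.
\<close>

definition ball_volume ::
  "('v, 'e) pre_digraph \<Rightarrow> ('e \<Rightarrow> real) \<Rightarrow> 'v \<Rightarrow> real \<Rightarrow> real" where
  "ball_volume G len v r =
     (\<Sum>\<^sub>\<infinity>a\<in>arcs G. measure lborel {t \<in> {0..len a}. dist_on_arc G len v a t \<le> ereal r}) / 2"

definition volume_entropy ::
  "('v, 'e) pre_digraph \<Rightarrow> ('e \<Rightarrow> 'e) \<Rightarrow> ('e \<Rightarrow> real) \<Rightarrow> real" where
  "volume_entropy G arev len =
     Max ((\<lambda>z. Lim at_top (\<lambda>r. ln (ball_volume (universal_cover G arev z) (cover_len len) [] r) / r))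
            ` verts G)"


section \<open>Attaching an edge\<close>

text \<open>
  The new edge consists of the arcs \<open>Inr True\<close>, from \<open>x\<close> to \<open>y\<close>, and \<open>Inr False\<close>, its reverse.
\<close>

definition attach_edge ::
  "('v, 'e) pre_digraph \<Rightarrow> 'v \<Rightarrow> 'v \<Rightarrow> ('v, 'e + bool) pre_digraph" where
  "attach_edge G x y =
    \<lparr> verts = verts G,
      arcs = arcs G <+> UNIV,
      tail = case_sum (tail G) (\<lambda>b. if b then x else y),
      head = case_sum (head G) (\<lambda>b. if b then y else x) \<rparr>"

definition attach_arev :: "('e \<Rightarrow> 'e) \<Rightarrow> 'e + bool \<Rightarrow> 'e + bool" where
  "attach_arev arev = map_sum arev Not"

definition attach_len :: "('e \<Rightarrow> real) \<Rightarrow> real \<Rightarrow> 'e + bool \<Rightarrow> real" where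
  "attach_len len l = case_sum len (\<lambda>_. l)"

lemma finite_metric_graph_attach_edge:
  assumes "finite_metric_graph G arev len" "x \<in> verts G" "y \<in> verts G" "l > 0"
  shows "finite_metric_graph (attach_edge G x y) (attach_arev arev) (attach_len len l)"
proof -
  interpret finite_metric_graph G arev len by fact
  have dom: "a \<in> arcs (attach_edge G x y) \<longleftrightarrow> attach_arev arev a \<noteq> a" for a
    using arev_dom by (cases a) (auto simp: attach_edge_def attach_arev_def)
  have inv: "attach_arev arev (attach_arev arev a) = a" for a
    by (cases a) (auto simp: attach_arev_def)
  show ?thesis
  proof (unfold_locales, goal_cases)
    case (3 a)
    then show ?case by (rule dom)
  next
    case (4 a)
    then show ?case by (simp add: inv)
  qed (use assms(2-4) len_pos len_arev in
         \<open>auto simp: attach_edge_def attach_arev_def attach_len_def simp flip: arev_dom\<close>)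
qed

end

(*
  Let B be the transfer operator of the non-backtracking walk with weight exp (-s |b|) on the arc b.
  The volume entropy of a connected graph is the critical exponent h of the Green function
  E_s = 1 + B E_s: the number of walks of length at most r satisfies a renewal equation, for which
  E_s exp (s r) is a supersolution if s > h, and (E_s / max E_s) exp (s r) is almost a subsolution
  as s decreases to h.

  If h = 0, it is enough that h' is bounded. If h > 0, the generating function F_uv of the walks
  from u to v in G has a simple pole at h. It is meromorphic there, by elimination in the linear
  system for E_s. An arc from which some arc and its reverse can both be reached has E_s comparable
  to the maximum of E_s, and on the other arcs E_s is bounded. Hence, for h < t < s, the normalised
  E_t is up to a bounded term a strict supersolution for B, which gives E_s <= C / (s - h).

  The Perron vector of the return matrix of the two new arcs extends to all arcs of the attached
  graph such that the transfer operator fixes it on the old arcs. So h' is the root s of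
  exp (-s l) (F_xy + sqrt (L_x L_y)) = 1, where L_v = F_vv - 1. The bracket is A / (s - h) + O(1),
  whence h' = h + A exp (-h l) + O(l exp (-2 h l)).
*)
theory Submission
  imports Defs "HOL-Complex_Analysis.Complex_Analysis"
begin

section \<open>Growth rates and asymptotic roots\<close>

text \<open>The obstacle is that the transfer operator need not be irreducible: an arc leading into
  a hanging tree has a bounded Green function however close \<open>s\<close> is to the critical
  exponent, so Perron-Frobenius theory does not apply as it stands. The substitute is a Harnack
  inequality for \<open>vgreen\<close>, the sum over all walks from a vertex: prepending an arc and
  cancelling a backtrack, if one arises, changes lengths in a controlled way, so any two vertices of
  a connected graph are comparable, uniformly in \<open>s\<close>.

  Bounds of order \<open>1 / (s - h)\<close> from both sides would only trap
  \<open>(s - h) * F\<close> between constants. Meromorphy supplies the limit and the linear rate,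
  and it asks for nothing but linear algebra with coefficients analytic in \<open>s\<close>.\<close>

lemma ex_exp_small:
  fixes m c :: real assumes "0 < m" "0 \<le> c"
  obtains s where "0 < s" "c * exp (- s * m) \<le> 1/2"
proof
  define K where "K = 2 * c + 1"
  have K: "0 < K" "2 * c \<le> exp K"
    using exp_ge_add_one_self[of K] assms unfolding K_def by linarith+
  show "0 < K / m" using K assms by simp
  have "- (K / m) * m = - K" using assms by simp
  moreover have "c * exp (- K) \<le> 1/2"
    using K by (simp add: exp_minus divide_simps)
  ultimately show "c * exp (- (K / m) * m) \<le> 1/2" by simp
qed

text \<open>The constant \<open>K\<close> may depend on \<open>s\<close> and blow up as
  \<open>s\<close> decreases to \<open>h\<close>, because dividing its logarithm by \<open>r\<close>
  removes it. Convergence of the Green function strictly above the critical exponent provides no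
  more than this.\<close>

lemma growth_rate_tendsto:
  fixes f :: "real \<Rightarrow> real"
  assumes c: "0 < c" "\<And>r. r0 \<le> r \<Longrightarrow> c * exp (h * r) \<le> f r"
    and K: "\<And>s. h < s \<Longrightarrow> \<exists>K>0. \<forall>r\<ge>0. f r \<le> K * exp (s * r)"
  shows "((\<lambda>r. ln (f r) / r) \<longlongrightarrow> h) at_top"
proof (rule order_tendstoI)
  fix a assume "a < h"
  have "((\<lambda>r. ln c / r + h) \<longlongrightarrow> 0 + h) at_top"
    by (intro tendsto_add tendsto_const real_tendsto_divide_at_top[OF tendsto_const] filterlim_ident)
  then have "\<forall>\<^sub>F r in at_top. a < ln c / r + h"
    using \<open>a < h\<close> by (auto dest: order_tendstoD)
  then show "\<forall>\<^sub>F r in at_top. a < ln (f r) / r"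
    using eventually_ge_at_top[of r0] eventually_gt_at_top[of 0]
  proof eventually_elim
    case (elim r)
    have "ln (c * exp (h * r)) \<le> ln (f r)"
      using c elim by (meson exp_gt_zero less_le_trans ln_le_cancel_iff mult_pos_pos)
    then have "(ln c + h * r) / r \<le> ln (f r) / r"
      using c elim by (intro divide_right_mono) (auto simp: ln_mult)
    then show ?case using elim by (simp add: add_divide_distrib)
  qed
next
  fix a assume "h < a"
  define s where "s = (h + a) / 2"
  have s: "h < s" "s < a" using \<open>h < a\<close> by (auto simp: s_def)
  obtain K where K': "0 < K" "\<And>r. 0 \<le> r \<Longrightarrow> f r \<le> K * exp (s * r)" using K[OF s(1)] by blast
  have "((\<lambda>r. ln K / r + s) \<longlongrightarrow> 0 + s) at_top"
    by (intro tendsto_add tendsto_const real_tendsto_divide_at_top[OF tendsto_const] filterlim_ident)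
  then have "\<forall>\<^sub>F r in at_top. ln K / r + s < a"
    using s by (auto dest: order_tendstoD)
  then show "\<forall>\<^sub>F r in at_top. ln (f r) / r < a"
    using eventually_ge_at_top[of r0] eventually_gt_at_top[of 0]
  proof eventually_elim
    case (elim r)
    have "0 < f r" using c elim by (meson exp_gt_zero less_le_trans mult_pos_pos)
    then have "ln (f r) \<le> ln (K * exp (s * r))"
      using K' elim by (subst ln_le_cancel_iff) auto
    then have "ln (f r) / r \<le> (ln K + s * r) / r"
      using K' elim by (intro divide_right_mono) (auto simp: ln_mult)
    then show ?case using elim by (simp add: add_divide_distrib)
  qed
qed

text \<open>With \<open>q = exp (- h * l)\<close> the approximate root is \<open>h + A * q\<close>.
  The hypotheses locate \<open>h' l\<close> from one side at a test point, so two points at distance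
  \<open>K * l * q * q\<close> from the approximate root suffice. The factor \<open>l\<close> stems
  from \<open>exp (- (s - h) * l)\<close>, which is \<open>1 - O(l * q)\<close> there.\<close>

lemma asymptotic_root:
  fixes h A M \<epsilon> :: real and \<rho> h' :: "real \<Rightarrow> real"
  assumes "0 < h" "0 < A" "0 < M" "0 < \<epsilon>"
    and \<rho>: "\<And>s. h < s \<Longrightarrow> s < h + \<epsilon> \<Longrightarrow> \<bar>(s - h) * \<rho> s - A\<bar> \<le> M * (s - h)"
    and le: "\<And>l s. 0 < l \<Longrightarrow> h < s \<Longrightarrow> s < h + \<epsilon> \<Longrightarrow> exp (- s * l) * \<rho> s < 1 \<Longrightarrow> h' l \<le> s"
    and ge: "\<And>l s. 0 < l \<Longrightarrow> h < s \<Longrightarrow> s < h + \<epsilon> \<Longrightarrow> 1 \<le> exp (- s * l) * \<rho> s \<Longrightarrow> s \<le> h' l"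
  shows "\<exists>K. \<forall>\<^sub>F l in at_top. \<bar>h' l - (h + A * exp (- h * l))\<bar> \<le> K * (l * exp (- h * l) * exp (- h * l))"
proof -
  \<comment> \<open>\<open>2 * M * A\<close> serves the upper test point, where
    \<open>s - h < 2 * A * q\<close>. At the lower one, \<open>M * A\<close> pays for the error of
    \<rho> and \<open>A\<^sup>2\<close> for the estimate
    \<open>1 - \<eta> * l \<le> exp (- \<eta> * l)\<close>.\<close>
  define K where "K = 2 * M * A + 1 + A\<^sup>2"
  have K: "0 < K" "2 * M * A < K" "M * A + A\<^sup>2 \<le> K"
    using assms by (auto simp: K_def add_pos_nonneg)
  have lim: "((\<lambda>l. l * exp (- h * l)) \<longlongrightarrow> 0) at_top"
    using \<open>0 < h\<close> by real_asymp
  have lim': "((\<lambda>l. exp (- h * l)) \<longlongrightarrow> 0) at_top"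
    using \<open>0 < h\<close> by real_asymp
  have e1: "\<forall>\<^sub>F l in at_top. l * exp (- h * l) < min (A / K) (1 / A)"
    using lim K(1) assms(2) by (intro order_tendstoD(2)) auto
  have e2: "\<forall>\<^sub>F l in at_top. exp (- h * l) < min (\<epsilon> / (2 * A)) (A / (M * A))"
    using lim' assms by (intro order_tendstoD(2)) auto
  have "\<forall>\<^sub>F l in at_top. \<bar>h' l - (h + A * exp (- h * l))\<bar> \<le> K * (l * exp (- h * l) * exp (- h * l))"
    using e1 e2 eventually_ge_at_top[of 1]
  proof eventually_elim
    case (elim l)
    define q where "q = exp (- h * l)"
    have q: "0 < q" "K * (l * q) < A" "A * (l * q) < 1" "2 * A * q < \<epsilon>" "M * q < 1" "1 \<le> l"
      using elim K(1) assms by (auto simp: q_def field_simps)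
    define \<delta> where "\<delta> = A * q + K * (l * q) * q"
    have \<delta>: "0 < \<delta>" "\<delta> < 2 * A * q"
    proof -
      show "0 < \<delta>" unfolding \<delta>_def using q K(1) assms(2) by (intro add_pos_pos mult_pos_pos) auto
      have "K * (l * q) * q < A * q" using q by (intro mult_strict_right_mono) auto
      then show "\<delta> < 2 * A * q" by (simp add: \<delta>_def)
    qed
    have "exp (- (h + \<delta>) * l) * \<rho> (h + \<delta>) < 1"
    proof -
      have b: "\<bar>\<delta> * \<rho> (h + \<delta>) - A\<bar> \<le> M * \<delta>"
        using \<rho>[of "h + \<delta>"] \<delta> q by simp
      have "M * \<delta> < K * (l * q)"
      proof -
        have "M * \<delta> < M * (2 * A * q)" using \<delta> assms by (intro mult_strict_left_mono) auto
        also have "\<dots> = 2 * M * A * q" by simp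
        also have "\<dots> \<le> K * (l * q)" using K q assms by (intro mult_mono) auto
        finally show ?thesis .
      qed
      then have "\<delta> * \<rho> (h + \<delta>) < A + K * (l * q)" using b by linarith
      then have "q * (\<delta> * \<rho> (h + \<delta>)) < q * (A + K * (l * q))" using q by (intro mult_strict_left_mono) auto
      also have "\<dots> = \<delta>" by (simp add: \<delta>_def algebra_simps)
      finally have *: "q * \<rho> (h + \<delta>) < 1" using \<delta> by (simp add: mult.left_commute)
      have "exp (- (h + \<delta>) * l) = q * exp (- \<delta> * l)" by (simp add: q_def exp_add[symmetric] algebra_simps)
      moreover have E: "0 < exp (- \<delta> * l)" "exp (- \<delta> * l) \<le> 1" using \<delta> q by auto
      have "exp (- \<delta> * l) * (q * \<rho> (h + \<delta>)) < 1"
      proof (cases "0 \<le> q * \<rho> (h + \<delta>)")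
        case True
        then have "exp (- \<delta> * l) * (q * \<rho> (h + \<delta>)) \<le> 1 * (q * \<rho> (h + \<delta>))"
          by (intro mult_right_mono E)
        then show ?thesis using * by simp
      next
        case False
        then have "exp (- \<delta> * l) * (q * \<rho> (h + \<delta>)) \<le> 0"
          using mult_nonneg_nonpos[OF less_imp_le[OF E(1)]] by simp
        then show ?thesis by simp
      qed
      ultimately show ?thesis by (simp add: mult_ac)
    qed
    then have upper: "h' l \<le> h + \<delta>" using \<delta> q by (intro le) auto
    define \<eta> where "\<eta> = A * q - K * (l * q) * q"
    have \<eta>: "0 < \<eta>" "\<eta> \<le> A * q"
    proof -
      have "K * (l * q) * q < A * q" using q by (intro mult_strict_right_mono) auto
      then show "0 < \<eta>" by (simp add: \<eta>_def)
      show "\<eta> \<le> A * q" using q K(1) by (simp add: \<eta>_def)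
    qed
    have \<eta>\<epsilon>: "\<eta> < \<epsilon>" using \<eta> q mult_pos_pos[OF assms(2) q(1)] by linarith
    have \<eta>l: "\<eta> * l \<le> A * q * l" using \<eta> q by (intro mult_right_mono) auto
    have "1 \<le> exp (- (h + \<eta>) * l) * \<rho> (h + \<eta>)"
    proof -
      have b: "\<bar>\<eta> * \<rho> (h + \<eta>) - A\<bar> \<le> M * \<eta>"
        using \<rho>[of "h + \<eta>"] \<eta> \<eta>\<epsilon> by simp
      have M\<eta>: "M * \<eta> \<le> M * (A * q)" using \<eta> assms by (intro mult_left_mono) auto
      have "A - K * (l * q) \<le> (1 - \<eta> * l) * (A - M * \<eta>)"
      proof -
        have "M * A * q \<le> M * A * (l * q)" using q assms by (intro mult_left_mono) auto
        moreover have "A * (\<eta> * l) \<le> A\<^sup>2 * (l * q)"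
          using mult_left_mono[OF \<eta>l, of A] assms by (simp add: power2_eq_square mult_ac)
        moreover have "(M * A + A\<^sup>2) * (l * q) \<le> K * (l * q)" using K q by (intro mult_right_mono) auto
        moreover have "0 \<le> M * \<eta> * (\<eta> * l)" using \<eta> q assms by simp
        ultimately show ?thesis using M\<eta> by (simp add: algebra_simps)
      qed
      also have "\<dots> \<le> exp (- \<eta> * l) * (\<eta> * \<rho> (h + \<eta>))"
      proof (intro mult_mono)
        show "1 - \<eta> * l \<le> exp (- \<eta> * l)" using exp_ge_add_one_self[of "- \<eta> * l"] by simp
        show "A - M * \<eta> \<le> \<eta> * \<rho> (h + \<eta>)" using b by linarith
        have "M * (A * q) = A * (M * q)" by simp
        also have "\<dots> \<le> A * 1" using q assms by (intro mult_left_mono) auto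
        finally show "0 \<le> A - M * \<eta>" using M\<eta> by simp
      qed simp
      finally have "q * (A - K * (l * q)) \<le> q * (exp (- \<eta> * l) * (\<eta> * \<rho> (h + \<eta>)))"
        using q by (intro mult_left_mono) auto
      moreover have "q * (A - K * (l * q)) = \<eta>" by (simp add: \<eta>_def algebra_simps)
      moreover have "exp (- (h + \<eta>) * l) = q * exp (- \<eta> * l)"
        by (simp add: q_def exp_add[symmetric] algebra_simps)
      ultimately have "\<eta> * 1 \<le> \<eta> * (exp (- (h + \<eta>) * l) * \<rho> (h + \<eta>))"
        by (simp only: mult_ac mult_1)
      then show ?thesis using \<eta>(1) by (simp only: mult_le_cancel_left_pos)
    qed
    then have lower: "h + \<eta> \<le> h' l"
      using \<eta> \<eta>\<epsilon> q by (intro ge) auto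
    show ?case
      using upper lower unfolding \<delta>_def \<eta>_def q_def by (simp add: mult.assoc)
  qed
  then show ?thesis by blast
qed

section \<open>Germs of meromorphic functions\<close>

text \<open>The functions at hand are series known to converge only for real \<open>s > h\<close>.
  The germ records just their values to the right of \<open>h\<close>, as those of a complex
  function meromorphic at \<open>h\<close>, where the theory of isolated singularities is
  available.\<close>

definition mero_germ :: "real \<Rightarrow> (real \<Rightarrow> real) \<Rightarrow> bool" where
  "mero_germ h g \<longleftrightarrow> (\<exists>f. f meromorphic_on {of_real h} \<and>
     (\<forall>\<^sub>F s in at_right h. f (of_real s) = of_real (g s)))"

lemma mero_germ_cong:
  assumes "mero_germ h f" "\<forall>\<^sub>F s in at_right h. f s = g s"
  shows "mero_germ h g"
proof -
  obtain F where "F meromorphic_on {of_real h}" "\<forall>\<^sub>F s in at_right h. F (of_real s) = of_real (f s)"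
    using assms(1) unfolding mero_germ_def by blast
  moreover from this(2) assms(2) have "\<forall>\<^sub>F s in at_right h. F (of_real s) = of_real (g s)"
    by eventually_elim simp
  ultimately show ?thesis unfolding mero_germ_def by blast
qed

lemma mero_germ_binop:
  assumes "mero_germ h f" "mero_germ h g"
    and mero: "\<And>F G. F meromorphic_on {of_real h} \<Longrightarrow> G meromorphic_on {of_real h} \<Longrightarrow>
      (\<lambda>z. opc (F z) (G z)) meromorphic_on {of_real h}"
    and of_real: "\<And>x y. opc (of_real x) (of_real y) = of_real (opr x y)"
  shows "mero_germ h (\<lambda>s. opr (f s) (g s))"
proof -
  obtain F G where F: "F meromorphic_on {of_real h}" "\<forall>\<^sub>F s in at_right h. F (of_real s) = of_real (f s)"
    and G: "G meromorphic_on {of_real h}" "\<forall>\<^sub>F s in at_right h. G (of_real s) = of_real (g s)"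
    using assms(1,2) unfolding mero_germ_def by blast
  have "\<forall>\<^sub>F s in at_right h. opc (F (of_real s)) (G (of_real s)) = of_real (opr (f s) (g s))"
    using F(2) G(2) by eventually_elim (simp add: of_real)
  then show ?thesis using mero[OF F(1) G(1)] unfolding mero_germ_def by blast
qed

lemma mero_germ_const [intro]: "mero_germ h (\<lambda>s. c)"
  unfolding mero_germ_def by (intro exI[of _ "\<lambda>_. of_real c"]) (auto intro: meromorphic_intros)

lemma mero_germ_ident [intro]: "mero_germ h (\<lambda>s. s)"
  unfolding mero_germ_def by (intro exI[of _ "\<lambda>z. z"]) (auto intro: meromorphic_intros)

lemma mero_germ_exp [intro]: "mero_germ h (\<lambda>s. exp (- s * c))"
  unfolding mero_germ_def
  by (intro exI[of _ "\<lambda>z. exp (- z * of_real c)"])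
     (auto intro!: analytic_on_imp_meromorphic_on analytic_intros simp: exp_of_real simp flip: of_real_mult of_real_minus)

lemma mero_germ_add [intro]: "mero_germ h f \<Longrightarrow> mero_germ h g \<Longrightarrow> mero_germ h (\<lambda>s. f s + g s)"
  by (rule mero_germ_binop[where opc = "(+)"]) (auto intro: meromorphic_intros)

lemma mero_germ_diff [intro]: "mero_germ h f \<Longrightarrow> mero_germ h g \<Longrightarrow> mero_germ h (\<lambda>s. f s - g s)"
  by (rule mero_germ_binop[where opc = "(-)"]) (auto intro: meromorphic_intros)

lemma mero_germ_mult [intro]: "mero_germ h f \<Longrightarrow> mero_germ h g \<Longrightarrow> mero_germ h (\<lambda>s. f s * g s)"
  by (rule mero_germ_binop[where opc = "(*)"]) (auto intro: meromorphic_intros)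

lemma mero_germ_divide [intro]: "mero_germ h f \<Longrightarrow> mero_germ h g \<Longrightarrow> mero_germ h (\<lambda>s. f s / g s)"
  by (rule mero_germ_binop[where opc = "(/)"]) (auto intro: meromorphic_intros)

lemma mero_germ_sum [intro]:
  assumes "\<And>i. i \<in> I \<Longrightarrow> mero_germ h (f i)"
  shows "mero_germ h (\<lambda>s. \<Sum>i\<in>I. f i s)"
  using assms by (induction I rule: infinite_finite_induct) (auto intro: mero_germ_const)

text \<open>
  Gaussian elimination. The positive source term \<open>b\<close> keeps the pivot \<open>1 - B a a\<close> positive.
\<close>

lemma mero_germ_linear_system:
  fixes f b :: "'a \<Rightarrow> real \<Rightarrow> real" and B :: "'a \<Rightarrow> 'a \<Rightarrow> real \<Rightarrow> real"
  assumes "finite S"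
    and "\<And>a. a \<in> S \<Longrightarrow> mero_germ h (b a)" "\<And>a c. a \<in> S \<Longrightarrow> c \<in> S \<Longrightarrow> mero_germ h (B a c)"
    and "\<forall>\<^sub>F s in at_right h. \<forall>a\<in>S. f a s = b a s + (\<Sum>c\<in>S. B a c s * f c s)"
    and "\<forall>\<^sub>F s in at_right h. \<forall>a\<in>S. 0 < b a s \<and> 0 < f a s \<and> (\<forall>c\<in>S. 0 \<le> B a c s)"
    and "a \<in> S"
  shows "mero_germ h (f a)"
  using assms
proof (induction S arbitrary: b B a rule: finite_induct)
  case empty
  then show ?case by simp
next
  case (insert p S)
  define d where "d = (\<lambda>s. 1 - B p p s)"
  have d: "mero_germ h d" unfolding d_def by (intro mero_germ_diff mero_germ_const insert.prems(2)) simp_all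
  have pivot: "\<forall>\<^sub>F s in at_right h. 0 < d s \<and> f p s = (b p s + (\<Sum>c\<in>S. B p c s * f c s)) / d s"
    using insert.prems(3,4)
  proof eventually_elim
    case (elim s)
    have "f p s = b p s + (\<Sum>c\<in>insert p S. B p c s * f c s)" using elim(1) by blast
    also have "\<dots> = b p s + (B p p s * f p s + (\<Sum>c\<in>S. B p c s * f c s))"
      using insert.hyps by simp
    finally have "f p s = b p s + (B p p s * f p s + (\<Sum>c\<in>S. B p c s * f c s))" .
    then have eq: "f p s * d s = b p s + (\<Sum>c\<in>S. B p c s * f c s)"
      by (simp add: d_def algebra_simps)
    have "0 \<le> (\<Sum>c\<in>S. B p c s * f c s)"
      using elim(2) by (intro sum_nonneg mult_nonneg_nonneg) (auto intro: less_imp_le)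
    then have "0 < f p s * d s" using eq elim(2) by simp
    then have "0 < d s" using elim(2) by (simp add: zero_less_mult_iff)
    then show ?case using eq by (simp add: field_simps)
  qed
  have IH: "mero_germ h (f a)" if "a \<in> S" for a
  proof (rule insert.IH[where b = "\<lambda>a s. b a s + B a p s * b p s / d s"
        and B = "\<lambda>a c s. B a c s + B a p s * B p c s / d s"])
    show "mero_germ h (\<lambda>s. b a s + B a p s * b p s / d s)" if "a \<in> S" for a
      using that insert.prems(1,2) d by (intro mero_germ_add mero_germ_divide mero_germ_mult) auto
    show "mero_germ h (\<lambda>s. B a c s + B a p s * B p c s / d s)" if "a \<in> S" "c \<in> S" for a c
      using that insert.prems(2) d by (intro mero_germ_add mero_germ_divide mero_germ_mult) auto
    show "\<forall>\<^sub>F s in at_right h. \<forall>a\<in>S. f a s = b a s + B a p s * b p s / d s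
        + (\<Sum>c\<in>S. (B a c s + B a p s * B p c s / d s) * f c s)"
      using insert.prems(3) pivot
    proof eventually_elim
      case (elim s)
      show ?case
      proof
        fix a assume a: "a \<in> S"
        have "f a s = b a s + (\<Sum>c\<in>insert p S. B a c s * f c s)" using elim(1) a by blast
        also have "\<dots> = b a s + (B a p s * f p s + (\<Sum>c\<in>S. B a c s * f c s))"
          using insert.hyps by simp
        also have "B a p s * f p s = B a p s * b p s / d s + (\<Sum>c\<in>S. B a p s * B p c s / d s * f c s)"
          using elim(2) by (simp add: add_divide_distrib distrib_left sum_distrib_left sum_divide_distrib mult_ac)
        finally show "f a s = b a s + B a p s * b p s / d s
            + (\<Sum>c\<in>S. (B a c s + B a p s * B p c s / d s) * f c s)"
          by (simp add: distrib_right sum.distrib)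
      qed
    qed
    show "\<forall>\<^sub>F s in at_right h. \<forall>a\<in>S. 0 < b a s + B a p s * b p s / d s \<and> 0 < f a s
        \<and> (\<forall>c\<in>S. 0 \<le> B a c s + B a p s * B p c s / d s)"
      using insert.prems(4) pivot
    proof eventually_elim
      case (elim s)
      have "0 \<le> B a p s * b p s / d s" "\<And>c. c \<in> S \<Longrightarrow> 0 \<le> B a p s * B p c s / d s" if "a \<in> S" for a
        using elim that by (auto intro!: divide_nonneg_pos mult_nonneg_nonneg less_imp_le[of 0 "b p s"])
      then show ?case using elim(1) by (auto intro: add_pos_nonneg)
    qed
  qed (rule that)
  show ?case
  proof (cases "a = p")
    case True
    have "mero_germ h (\<lambda>s. (b p s + (\<Sum>c\<in>S. B p c s * f c s)) / d s)"
      using insert.prems(1,2) d IH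
      by (intro mero_germ_add mero_germ_divide mero_germ_mult mero_germ_sum) auto
    then show ?thesis
      unfolding True by (rule mero_germ_cong) (use pivot in \<open>eventually_elim, simp\<close>)
  next
    case False
    then show ?thesis using IH insert.prems(5) by simp
  qed
qed

lemma filterlim_of_real_at_right: "filterlim of_real (at (of_real h :: complex)) (at_right h)"
proof -
  have "((\<lambda>s. complex_of_real s) \<longlongrightarrow> of_real h) (at_right h)"
    by (intro tendsto_intros)
  moreover have "\<forall>\<^sub>F s in at_right h. complex_of_real s \<noteq> of_real h"
    unfolding eventually_at_filter by simp
  ultimately show ?thesis unfolding filterlim_at by auto
qed

text \<open>A meromorphic function has no essential singularity, and a bound along the real ray
  excludes a pole. So the singularity is removable; \<open>A\<close> is the real part of the value
  filled in and \<open>M\<close> comes from the derivative there.\<close>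

lemma mero_germ_bounded:
  assumes "mero_germ h g" "\<forall>\<^sub>F s in at_right h. \<bar>g s\<bar> \<le> K"
  obtains A M where "0 < M" "\<forall>\<^sub>F s in at_right h. \<bar>g s - A\<bar> \<le> M * (s - h)"
proof -
  let ?z = "of_real h :: complex"
  obtain f where f: "f meromorphic_on {?z}" "\<forall>\<^sub>F s in at_right h. f (of_real s) = of_real (g s)"
    using assms(1) unfolding mero_germ_def by blast
  have sing: "isolated_singularity_at f ?z" "not_essential f ?z"
    using f(1) by (auto simp: meromorphic_at_iff)
  have "\<not> is_pole f ?z"
  proof
    assume "is_pole f ?z"
    then have "filterlim f at_infinity (at ?z)" by (simp add: is_pole_def)
    then have "filterlim (\<lambda>s. f (of_real s)) at_infinity (at_right h)"
      by (rule filterlim_compose[OF _ filterlim_of_real_at_right])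
    then have "\<forall>\<^sub>F s in at_right h. \<bar>K\<bar> + 1 \<le> norm (f (of_real s))"
      unfolding filterlim_at_infinity[OF order_refl] by simp
    with f(2) assms(2) have "\<forall>\<^sub>F s in at_right h. False"
      by eventually_elim auto
    then show False by simp
  qed
  then obtain c where c: "f \<midarrow>?z\<rightarrow> c" using sing(2) unfolding not_essential_def by blast
  \<comment> \<open>The value of \<open>f\<close> at \<open>h\<close> itself is arbitrary and has to
    be replaced by the limit before differentiating.\<close>
  define F where "F = remove_sings f"
  have F: "F \<midarrow>?z\<rightarrow> c" "F ?z = c"
    using c sing(1) unfolding F_def by auto
  have "F meromorphic_on {?z}" unfolding F_def using f(1) by (rule remove_sings_meromorphic)
  moreover have "isCont F ?z" unfolding isCont_def using F by simp
  ultimately have "F analytic_on {?z}" by (rule meromorphic_at_isCont_imp_analytic)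
  then have "F field_differentiable (at ?z)"
    by (rule analytic_on_imp_differentiable_at) simp
  then obtain D where "(F has_field_derivative D) (at ?z)"
    by (auto simp: field_differentiable_def)
  then have "((\<lambda>w. (F w - F ?z) / (w - ?z)) \<longlongrightarrow> D) (at ?z)"
    by (simp add: has_field_derivative_iff)
  then have "((\<lambda>w. norm ((F w - F ?z) / (w - ?z))) \<longlongrightarrow> norm D) (at ?z)"
    by (rule tendsto_norm)
  then have "\<forall>\<^sub>F w in at ?z. norm ((F w - F ?z) / (w - ?z)) < norm D + 1"
    by (rule order_tendstoD) simp
  moreover have "\<forall>\<^sub>F w in at ?z. F w = f w"
    unfolding F_def by (rule eventually_remove_sings_eq_at[OF sing(1)])
  ultimately have "\<forall>\<^sub>F w in at ?z. norm ((f w - c) / (w - ?z)) < norm D + 1"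
    by eventually_elim (simp add: F)
  then have "\<forall>\<^sub>F s in at_right h. norm ((f (of_real s) - c) / (of_real s - ?z)) < norm D + 1"
    using filterlim_of_real_at_right[of h] unfolding filterlim_iff by blast
  moreover have "\<forall>\<^sub>F s in at_right h. h < s" by (rule eventually_at_right_less)
  ultimately have "\<forall>\<^sub>F s in at_right h. \<bar>g s - Re c\<bar> \<le> (norm D + 1) * (s - h)"
    using f(2)
  proof eventually_elim
    case (elim s)
    have "norm (complex_of_real s - ?z) = s - h"
      using elim(2) by (simp flip: of_real_diff)
    then have "norm (f (of_real s) - c) < (norm D + 1) * (s - h)"
      using elim(1,2) by (simp add: norm_divide divide_less_eq)
    moreover have "\<bar>g s - Re c\<bar> \<le> norm (f (of_real s) - c)"
      using abs_Re_le_cmod[of "f (of_real s) - c"] elim(3) by simp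
    ultimately show ?case by linarith
  qed
  then show ?thesis using that[of "norm D + 1" "Re c"] by (smt (verit) norm_ge_zero)
qed

section \<open>The transfer operator and its Green function\<close>

context finite_metric_graph begin

definition succs :: "'e \<Rightarrow> 'e set" where
  "succs a = {b \<in> out_arcs G (head G a). b \<noteq> arev a}"

definition wt :: "real \<Rightarrow> 'e \<Rightarrow> real" where
  "wt s a = exp (- s * len a)"

text \<open>The weight is that of the successor, so the starting arc is never charged; a walk that
  begins with \<open>a\<close> picks up \<open>wt s a\<close> separately, as in
  \<open>vgreen\<close>.\<close>

definition transfer :: "real \<Rightarrow> ('e \<Rightarrow> real) \<Rightarrow> 'e \<Rightarrow> real" where
  "transfer s f a = (\<Sum>b\<in>succs a. wt s b * f b)"

text \<open>
  The sum of \<open>exp (- s * path_length len q) * \<phi> v\<close> over all paths \<open>q\<close> that may follow the arc \<open>a\<close>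
  without backtracking, where \<open>v\<close> is the end of \<open>q\<close>.
\<close>

definition green :: "real \<Rightarrow> ('v \<Rightarrow> real) \<Rightarrow> 'e \<Rightarrow> real" where
  "green s \<phi> a = (\<Sum>n. (transfer s ^^ n) (\<lambda>b. \<phi> (head G b)) a)"

text \<open>The empty walk contributes \<open>\<phi> z\<close>. With the indicator of
  \<open>v\<close> this is the generating function of the walks from \<open>z\<close> to
  \<open>v\<close> without backtracking.\<close>

definition vgreen :: "real \<Rightarrow> ('v \<Rightarrow> real) \<Rightarrow> 'v \<Rightarrow> real" where
  "vgreen s \<phi> z = \<phi> z + (\<Sum>a\<in>out_arcs G z. wt s a * green s \<phi> a)"

text \<open>
  Convergence of \<open>green s (\<lambda>_. 1)\<close>, stated by a strict supersolution because this form is stable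
  under changes of \<open>s\<close> and can be checked by exhibiting \<open>w\<close>.
\<close>

definition convergent_at :: "real \<Rightarrow> bool" where
  "convergent_at s \<longleftrightarrow> (\<exists>w. \<forall>a\<in>arcs G. 0 \<le> w a \<and> 1 + transfer s w a \<le> w a)"

definition crit :: real where
  "crit = Inf {s. 0 < s \<and> convergent_at s}"

definition min_len :: real where
  "min_len = Min (insert 1 (len ` arcs G))"

definition max_len :: real where
  "max_len = Max (insert 1 (len ` arcs G))"

lemma min_len_pos: "0 < min_len"
  unfolding min_len_def using len_pos by (subst Min_gr_iff) auto

lemma min_len_le: "a \<in> arcs G \<Longrightarrow> min_len \<le> len a"
  unfolding min_len_def by (intro Min_le) auto

lemma max_len_ge: "a \<in> arcs G \<Longrightarrow> len a \<le> max_len"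
  unfolding max_len_def by (intro Max_ge) auto

lemma max_len_pos: "0 < max_len"
proof -
  have "1 \<le> max_len"
    unfolding max_len_def by (intro Max_ge) auto
  then show ?thesis by simp
qed

lemma finite_succs [simp]: "finite (succs a)"
  unfolding succs_def by (rule finite_subset[OF _ finite_arcs]) auto

lemma succs_arcs: "b \<in> succs a \<Longrightarrow> b \<in> arcs G"
  by (auto simp: succs_def)

lemma succs_subset: "succs a \<subseteq> arcs G"
  by (auto simp: succs_def)

declare finite_out_arcs [simp]

lemma out_arcs_head:
  assumes "a \<in> arcs G"
  shows "out_arcs G (head G a) = insert (arev a) (succs a)" "arev a \<notin> succs a"
  using assms by (auto simp: succs_def)

lemma succs_arev:
  assumes "a \<in> arcs G" "b \<in> arcs G"
  shows "arev a \<in> succs (arev b) \<longleftrightarrow> b \<in> succs a"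
  using assms by (auto simp: succs_def arev_eq_iff)

lemma wt_pos [simp]: "0 < wt s a" and wt_nonneg [simp]: "0 \<le> wt s a"
  by (simp_all add: wt_def)

lemma wt_arev: "a \<in> arcs G \<Longrightarrow> wt s (arev a) = wt s a"
  by (simp add: wt_def len_arev)

lemma wt_le_1: "0 \<le> s \<Longrightarrow> a \<in> arcs G \<Longrightarrow> wt s a \<le> 1"
  using len_pos[of a] by (simp add: wt_def)

lemma wt_antimono: "s \<le> t \<Longrightarrow> a \<in> arcs G \<Longrightarrow> wt t a \<le> wt s a"
  using len_pos[of a] by (simp add: wt_def)

lemma transfer_mono:
  assumes "\<And>b. b \<in> arcs G \<Longrightarrow> f b \<le> g b"
  shows "transfer s f a \<le> transfer s g a"
  unfolding transfer_def using assms by (intro sum_mono mult_left_mono) (auto dest: succs_arcs)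

lemma transfer_nonneg:
  assumes "\<And>b. b \<in> arcs G \<Longrightarrow> 0 \<le> f b"
  shows "0 \<le> transfer s f a"
  unfolding transfer_def using assms by (intro sum_nonneg mult_nonneg_nonneg) (auto dest: succs_arcs)

lemma transfer_antimono:
  assumes "\<And>b. b \<in> arcs G \<Longrightarrow> 0 \<le> f b" "s \<le> t"
  shows "transfer t f a \<le> transfer s f a"
  unfolding transfer_def using assms
  by (intro sum_mono mult_right_mono wt_antimono) (auto dest: succs_arcs)

lemma transfer_add: "transfer s (\<lambda>b. f b + g b) a = transfer s f a + transfer s g a"
  by (simp add: transfer_def sum.distrib distrib_left)

lemma transfer_cmult: "transfer s (\<lambda>b. c * f b) a = c * transfer s f a"
  by (simp add: transfer_def sum_distrib_left mult_ac)

lemma transfer_zero [simp]: "transfer s (\<lambda>b. 0) a = 0"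
  by (simp add: transfer_def)

lemma transfer_sum: "transfer s (\<lambda>b. \<Sum>i\<in>I. f i b) a = (\<Sum>i\<in>I. transfer s (f i) a)"
  unfolding transfer_def sum_distrib_left by (rule sum.swap)

lemma transfer_pow_nonneg:
  assumes "\<And>b. b \<in> arcs G \<Longrightarrow> 0 \<le> f b" "a \<in> arcs G"
  shows "0 \<le> (transfer s ^^ n) f a"
  using assms(2) by (induction n arbitrary: a) (auto simp: assms(1) intro: transfer_nonneg)

lemma transfer_pow_mono:
  assumes "\<And>b. b \<in> arcs G \<Longrightarrow> f b \<le> g b" "a \<in> arcs G"
  shows "(transfer s ^^ n) f a \<le> (transfer s ^^ n) g a"
  using assms(2) by (induction n arbitrary: a) (auto simp: assms(1) intro: transfer_mono)

lemma transfer_pow_cmult: "(transfer s ^^ n) (\<lambda>b. c * f b) a = c * (transfer s ^^ n) f a"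
proof (induction n arbitrary: a)
  case (Suc n)
  have "(transfer s ^^ n) (\<lambda>b. c * f b) = (\<lambda>b. c * (transfer s ^^ n) f b)"
    using Suc by blast
  then show ?case by (simp add: transfer_cmult)
qed simp

lemma transfer_pow_add:
  "(transfer s ^^ n) (\<lambda>b. f b + g b) a = (transfer s ^^ n) f a + (transfer s ^^ n) g a"
proof (induction n arbitrary: a)
  case (Suc n)
  have "(transfer s ^^ n) (\<lambda>b. f b + g b) = (\<lambda>b. (transfer s ^^ n) f b + (transfer s ^^ n) g b)"
    using Suc by blast
  then show ?case by (simp add: transfer_add)
qed simp

text \<open>Each partial sum is \<open>f\<close> plus the transfer of the previous one, so by
  induction all of them stay below any nonnegative supersolution \<open>w\<close>.\<close>

lemma transfer_partial_sums_le:
  assumes f: "\<And>a. a \<in> arcs G \<Longrightarrow> 0 \<le> f a"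
    and w: "\<And>a. a \<in> arcs G \<Longrightarrow> 0 \<le> w a" "\<And>a. a \<in> arcs G \<Longrightarrow> f a + transfer s w a \<le> w a"
    and a: "a \<in> arcs G"
  shows "(\<Sum>i<n. (transfer s ^^ i) f a) \<le> w a"
  using a
proof (induction n arbitrary: a)
  case 0
  then show ?case using w by simp
next
  case (Suc n)
  have "(\<Sum>i<Suc n. (transfer s ^^ i) f a) = f a + (\<Sum>i<n. transfer s ((transfer s ^^ i) f) a)"
    by (subst sum.lessThan_Suc_shift) simp
  also have "\<dots> = f a + transfer s (\<lambda>b. \<Sum>i<n. (transfer s ^^ i) f b) a"
    by (simp add: transfer_sum)
  also have "\<dots> \<le> f a + transfer s w a"
    using Suc.IH by (intro add_left_mono transfer_mono)
  also have "\<dots> \<le> w a" using w Suc.prems by blast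
  finally show ?case .
qed

lemma transfer_summable_le:
  assumes f: "\<And>a. a \<in> arcs G \<Longrightarrow> 0 \<le> f a"
    and w: "\<And>a. a \<in> arcs G \<Longrightarrow> 0 \<le> w a" "\<And>a. a \<in> arcs G \<Longrightarrow> f a + transfer s w a \<le> w a"
    and a: "a \<in> arcs G"
  shows "summable (\<lambda>n. (transfer s ^^ n) f a)" "(\<Sum>n. (transfer s ^^ n) f a) \<le> w a"
proof -
  show 1: "summable (\<lambda>n. (transfer s ^^ n) f a)"
    using transfer_partial_sums_le[OF f w, of a] transfer_pow_nonneg[of f] f a
    by (intro summableI_nonneg_bounded[where x = "w a"]) auto
  show "(\<Sum>n. (transfer s ^^ n) f a) \<le> w a"
    using transfer_partial_sums_le[OF f w a] 1 by (intro suminf_le_const) auto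
qed

lemma green_le:
  assumes "\<And>z. z \<in> verts G \<Longrightarrow> 0 \<le> \<phi> z"
    and "\<And>a. a \<in> arcs G \<Longrightarrow> 0 \<le> w a"
    and "\<And>a. a \<in> arcs G \<Longrightarrow> \<phi> (head G a) + transfer s w a \<le> w a"
    and "a \<in> arcs G"
  shows "green s \<phi> a \<le> w a"
  unfolding green_def by (intro transfer_summable_le) (auto simp: assms)

lemma convergent_summable:
  assumes conv: "convergent_at s" and f: "\<And>a. a \<in> arcs G \<Longrightarrow> 0 \<le> f a" and a: "a \<in> arcs G"
  shows "summable (\<lambda>n. (transfer s ^^ n) f a)"
proof -
  obtain w where w: "\<And>a. a \<in> arcs G \<Longrightarrow> 0 \<le> w a \<and> 1 + transfer s w a \<le> w a"
    using conv unfolding convergent_at_def by blast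
  define K where "K = (\<Sum>a\<in>arcs G. f a)"
  have K: "f b \<le> K" if "b \<in> arcs G" for b
    unfolding K_def using that f by (intro member_le_sum) auto
  have "0 \<le> K" unfolding K_def using f by (intro sum_nonneg)
  show ?thesis
  proof (rule transfer_summable_le(1)[OF f _ _ a])
    fix b assume b: "b \<in> arcs G"
    show "0 \<le> K * w b" using w[OF b] \<open>0 \<le> K\<close> by simp
    have "f b + transfer s (\<lambda>b. K * w b) b \<le> K * (1 + transfer s w b)"
      using K[OF b] by (simp add: transfer_cmult distrib_left)
    also have "\<dots> \<le> K * w b" using w[OF b] \<open>0 \<le> K\<close> by (intro mult_left_mono) auto
    finally show "f b + transfer s (\<lambda>b. K * w b) b \<le> K * w b" .
  qed
qed

lemma green_summable:
  assumes "convergent_at s" "\<And>z. z \<in> verts G \<Longrightarrow> 0 \<le> \<phi> z" "a \<in> arcs G"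
  shows "summable (\<lambda>n. (transfer s ^^ n) (\<lambda>b. \<phi> (head G b)) a)"
  using assms by (intro convergent_summable) auto

lemma green_nonneg:
  assumes "convergent_at s" "\<And>z. z \<in> verts G \<Longrightarrow> 0 \<le> \<phi> z" "a \<in> arcs G"
  shows "0 \<le> green s \<phi> a"
  unfolding green_def using assms by (intro suminf_nonneg green_summable transfer_pow_nonneg) auto

lemma green_eq:
  assumes "convergent_at s" "\<And>z. z \<in> verts G \<Longrightarrow> 0 \<le> \<phi> z" "a \<in> arcs G"
  shows "green s \<phi> a = \<phi> (head G a) + transfer s (green s \<phi>) a"
proof -
  let ?f = "\<lambda>b. \<phi> (head G b)"
  have s: "summable (\<lambda>n. (transfer s ^^ n) ?f b)" if "b \<in> arcs G" for b
    using assms that by (intro green_summable) auto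
  have "green s \<phi> a = ?f a + (\<Sum>n. (transfer s ^^ Suc n) ?f a)"
    using suminf_split_head[OF s[OF assms(3)]] by (simp add: green_def)
  also have "(\<Sum>n. (transfer s ^^ Suc n) ?f a)
      = (\<Sum>n. \<Sum>b\<in>succs a. wt s b * (transfer s ^^ n) ?f b)"
    by (simp add: transfer_def[of s _ a])
  also have "\<dots> = (\<Sum>b\<in>succs a. (\<Sum>n. wt s b * (transfer s ^^ n) ?f b))"
    by (rule suminf_sum) (intro summable_mult s succs_arcs)
  also have "\<dots> = transfer s (green s \<phi>) a"
    unfolding transfer_def[of s "green s \<phi>"] green_def
    by (intro sum.cong refl suminf_mult s succs_arcs)
  finally show ?thesis .
qed

lemma green_add:
  assumes "convergent_at s" "\<And>z. z \<in> verts G \<Longrightarrow> 0 \<le> \<phi> z" "\<And>z. z \<in> verts G \<Longrightarrow> 0 \<le> \<psi> z"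
    "a \<in> arcs G"
  shows "green s (\<lambda>z. \<phi> z + \<psi> z) a = green s \<phi> a + green s \<psi> a"
  unfolding green_def transfer_pow_add
  using assms by (intro suminf_add[symmetric] green_summable) auto

lemma green_mono:
  assumes "convergent_at s" "\<And>z. z \<in> verts G \<Longrightarrow> 0 \<le> \<phi> z" "\<And>z. z \<in> verts G \<Longrightarrow> \<phi> z \<le> \<psi> z"
    "a \<in> arcs G"
  shows "green s \<phi> a \<le> green s \<psi> a"
proof -
  have "0 \<le> \<psi> z" if "z \<in> verts G" for z
    using assms(2,3)[OF that] by linarith
  then show ?thesis
    unfolding green_def using assms
    by (intro suminf_le transfer_pow_mono green_summable) auto
qed

lemma convergent_at_mono:
  assumes "convergent_at s" "s \<le> t"
  shows "convergent_at t"
proof -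
  obtain w where w: "\<And>a. a \<in> arcs G \<Longrightarrow> 0 \<le> w a \<and> 1 + transfer s w a \<le> w a"
    using assms(1) unfolding convergent_at_def by blast
  have "1 + transfer t w a \<le> w a" if "a \<in> arcs G" for a
    using w[OF that] transfer_antimono[of w s t a] w assms(2) by fastforce
  then show ?thesis unfolding convergent_at_def using w by blast
qed

text \<open>The constant 2 is a supersolution. Any lower bound \<open>m\<close> of the lengths will
  do, so that one \<open>s\<close> can serve the attached graphs for all
  \<open>l \<ge> m\<close>.\<close>

lemma convergent_at_large:
  assumes "\<And>a. a \<in> arcs G \<Longrightarrow> m \<le> len a" "0 \<le> s" "card (arcs G) * exp (- s * m) \<le> 1/2"
  shows "convergent_at s"
proof -
  have "transfer s (\<lambda>_. 2) a \<le> 1" for a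
  proof -
    have "transfer s (\<lambda>_. 2) a \<le> (\<Sum>b\<in>arcs G. wt s b * 2)"
      unfolding transfer_def by (intro sum_mono2 succs_subset) auto
    also have "\<dots> \<le> (\<Sum>b\<in>arcs G. exp (- s * m) * 2)"
      unfolding wt_def using assms by (intro sum_mono mult_right_mono) (auto intro: mult_left_mono)
    also have "\<dots> \<le> 1" using assms(3) by simp
    finally show ?thesis .
  qed
  then show ?thesis unfolding convergent_at_def
    by (intro exI[of _ "\<lambda>_. 2"]) (auto simp: algebra_simps)
qed

lemma ex_convergent_at: "\<exists>s>0. convergent_at s"
proof -
  obtain s where "0 < s" "card (arcs G) * exp (- s * min_len) \<le> 1/2"
    using ex_exp_small[OF min_len_pos, of "real (card (arcs G))"] by auto
  then show ?thesis
    using convergent_at_large[OF min_len_le] by (intro exI[of _ s]) auto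
qed

lemma bdd_below_convergent: "bdd_below {s. 0 < s \<and> convergent_at s}"
  by (rule bdd_belowI[of _ 0]) auto

lemma crit_le: "0 < s \<Longrightarrow> convergent_at s \<Longrightarrow> crit \<le> s"
  unfolding crit_def by (intro cInf_lower bdd_below_convergent) auto

lemma crit_nonneg: "0 \<le> crit"
  unfolding crit_def using ex_convergent_at by (intro cInf_greatest) auto

lemma convergent_above_crit:
  assumes "crit < s" shows "convergent_at s"
proof -
  obtain t where "t < s" "convergent_at t"
    using assms ex_convergent_at bdd_below_convergent cInf_less_iff[of "{s. 0 < s \<and> convergent_at s}" s]
    unfolding crit_def by auto
  then show ?thesis using convergent_at_mono by (metis less_imp_le)
qed

lemma le_crit:
  assumes "\<not> convergent_at s" shows "s \<le> crit"
  using assms convergent_above_crit by force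

text \<open>A subsolution \<open>w\<close> stays below all its iterates, and these are at most
  \<open>M\<close> times the iterates of 1. So the terms of the series at \<open>a\<close> stay
  above \<open>w a / M\<close> and cannot tend to 0.\<close>

lemma not_convergent_at:
  assumes w: "\<And>a. a \<in> arcs G \<Longrightarrow> 0 \<le> w a" "\<And>a. a \<in> arcs G \<Longrightarrow> w a \<le> transfer s w a"
    and a: "a \<in> arcs G" "0 < w a"
  shows "\<not> convergent_at s"
proof
  assume conv: "convergent_at s"
  define M where "M = (\<Sum>b\<in>arcs G. w b)"
  have M: "w b \<le> M * 1" if "b \<in> arcs G" for b
    unfolding M_def using w that member_le_sum[of b "arcs G" w] by simp
  have "0 < M" using M[OF a(1)] a(2) by simp
  have "w b \<le> (transfer s ^^ n) w b" if "b \<in> arcs G" for n b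
    using that
  proof (induction n arbitrary: b)
    case (Suc n)
    then show ?case
      using w(2)[OF Suc.prems] transfer_mono[of w "(transfer s ^^ n) w" s b] by fastforce
  qed simp
  then have "w a \<le> M * (transfer s ^^ n) (\<lambda>_. 1) a" for n
    using transfer_pow_mono[of w "\<lambda>_. M * 1" a n s] M a(1)
    by (simp only: transfer_pow_cmult) (meson order_trans)
  then have "w a / M \<le> (transfer s ^^ n) (\<lambda>_. 1) a" for n
    using \<open>0 < M\<close> by (simp add: divide_le_eq mult.commute)
  moreover have "(\<lambda>n. (transfer s ^^ n) (\<lambda>_. 1) a) \<longlonglongrightarrow> 0"
    by (rule summable_LIMSEQ_zero[OF convergent_summable[OF conv _ a(1)]]) auto
  ultimately have "w a / M \<le> 0"
    by (intro LIMSEQ_le_const) auto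
  then show False using \<open>0 < M\<close> a(2) by (simp add: divide_le_0_iff)
qed

section \<open>Vertex sums and their comparison along walks\<close>

text \<open>Walks from \<open>head G b\<close> split according to whether they start with
  \<open>arev b\<close>; those that do not are exactly the walks that may follow
  \<open>b\<close>.\<close>

lemma vgreen_head:
  assumes "convergent_at s" "\<And>z. z \<in> verts G \<Longrightarrow> 0 \<le> \<phi> z" "b \<in> arcs G"
  shows "vgreen s \<phi> (head G b) = green s \<phi> b + wt s b * green s \<phi> (arev b)"
  using out_arcs_head[OF assms(3)] green_eq[OF assms] wt_arev[OF assms(3)]
  by (simp add: vgreen_def transfer_def)

lemma vgreen_tail:
  assumes "convergent_at s" "\<And>z. z \<in> verts G \<Longrightarrow> 0 \<le> \<phi> z" "b \<in> arcs G"
  shows "vgreen s \<phi> (tail G b) = green s \<phi> (arev b) + wt s b * green s \<phi> b"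
  using vgreen_head[OF assms(1,2), where b = "arev b"] assms(3) wt_arev[OF assms(3)] by simp

lemma vgreen_nonneg:
  assumes "convergent_at s" "\<And>z. z \<in> verts G \<Longrightarrow> 0 \<le> \<phi> z" "z \<in> verts G"
  shows "\<phi> z \<le> vgreen s \<phi> z"
  using assms unfolding vgreen_def by (auto intro!: sum_nonneg mult_nonneg_nonneg green_nonneg)

text \<open>The decompositions at the two ends of \<open>b\<close> have the same two terms with
  \<open>wt s b\<close> on different ones, so the claim reduces to
  \<open>wt s b * wt s b \<le> 1\<close>. In terms of walks: prepend \<open>arev b\<close>, and
  cancel if \<open>b\<close> follows.\<close>

lemma vgreen_arc:
  assumes "convergent_at s" "\<And>z. z \<in> verts G \<Longrightarrow> 0 \<le> \<phi> z" "b \<in> arcs G" "0 \<le> s"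
  shows "wt s b * vgreen s \<phi> (tail G b) \<le> vgreen s \<phi> (head G b)"
proof -
  have "wt s b * (wt s b * green s \<phi> b) \<le> 1 * (1 * green s \<phi> b)"
    using wt_le_1[OF assms(4,3)] green_nonneg[OF assms(1-3)]
    by (intro mult_mono) auto
  then show ?thesis
    by (simp add: vgreen_head[OF assms(1-3)] vgreen_tail[OF assms(1-3)] distrib_left)
qed

lemma vgreen_awalk:
  assumes "awalk u p v" "convergent_at s" "\<And>z. z \<in> verts G \<Longrightarrow> 0 \<le> \<phi> z" "0 \<le> s"
  shows "exp (- s * path_length len p) * vgreen s \<phi> u \<le> vgreen s \<phi> v"
  using assms(1)
proof (induction p arbitrary: u)
  case Nil
  then show ?case by (simp add: awalk_Nil_iff path_length_def)
next
  case (Cons b p)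
  have b: "b \<in> arcs G" "tail G b = u" "awalk (head G b) p v"
    using Cons.prems by (auto simp: awalk_Cons_iff)
  have "exp (- s * path_length len (b # p)) * vgreen s \<phi> u
      = exp (- s * path_length len p) * (wt s b * vgreen s \<phi> (tail G b))"
    using b(2) by (simp add: path_length_def wt_def distrib_left exp_add exp_diff exp_minus field_simps)
  also have "\<dots> \<le> exp (- s * path_length len p) * vgreen s \<phi> (head G b)"
    using vgreen_arc[OF assms(2,3) b(1) assms(4)] by (intro mult_left_mono) auto
  also have "\<dots> \<le> vgreen s \<phi> v" using Cons.IH[OF b(3)] .
  finally show ?case .
qed

lemma path_length_nonneg:
  assumes "set p \<subseteq> arcs G" shows "0 \<le> path_length len p"
  unfolding path_length_def using assms len_pos by (intro sum_list_nonneg) (auto intro!: less_imp_le)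

lemma strongly_connected_diameter:
  assumes "strongly_connected G"
  obtains D where "0 \<le> D"
    "\<And>u v. u \<in> verts G \<Longrightarrow> v \<in> verts G \<Longrightarrow> \<exists>p. awalk u p v \<and> path_length len p \<le> D"
proof -
  have "\<exists>p. awalk u p v" if "u \<in> verts G" "v \<in> verts G" for u v
    using assms that by (meson reachable_awalk strongly_connectedE)
  then obtain q where q: "\<And>u v. u \<in> verts G \<Longrightarrow> v \<in> verts G \<Longrightarrow> awalk u (q u v) v"
    by metis
  let ?l = "\<lambda>(u, v). path_length len (q u v)"
  have nonneg: "0 \<le> path_length len (q u v)" if "u \<in> verts G" "v \<in> verts G" for u v
    using q[OF that] by (intro path_length_nonneg) auto
  have "path_length len (q u v) \<le> sum ?l (verts G \<times> verts G)" if "u \<in> verts G" "v \<in> verts G" for u v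
    using member_le_sum[of "(u, v)" "verts G \<times> verts G" ?l] that nonneg by auto
  moreover have "0 \<le> sum ?l (verts G \<times> verts G)"
    using nonneg by (intro sum_nonneg) auto
  ultimately show ?thesis using that q by blast
qed

text \<open>A Harnack inequality: \<open>D\<close> depends neither on \<open>s\<close> nor on
  \<open>\<phi>\<close>. Single arcs admit no such comparison in general, since the walks after an
  arc may be trapped in a dead end.\<close>

lemma vgreen_compare:
  assumes "strongly_connected G"
  obtains D where "0 \<le> D"
    "\<And>u v s \<phi>. u \<in> verts G \<Longrightarrow> v \<in> verts G \<Longrightarrow> convergent_at s \<Longrightarrow> 0 \<le> s \<Longrightarrow>
       (\<And>z. z \<in> verts G \<Longrightarrow> 0 \<le> \<phi> z) \<Longrightarrow> exp (- s * D) * vgreen s \<phi> u \<le> vgreen s \<phi> v"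
proof -
  obtain D where D: "0 \<le> D"
    "\<And>u v. u \<in> verts G \<Longrightarrow> v \<in> verts G \<Longrightarrow> \<exists>p. awalk u p v \<and> path_length len p \<le> D"
    using strongly_connected_diameter[OF assms] by blast
  have "exp (- s * D) * vgreen s \<phi> u \<le> vgreen s \<phi> v"
    if *: "u \<in> verts G" "v \<in> verts G" "convergent_at s" "0 \<le> s"
       "\<And>z. z \<in> verts G \<Longrightarrow> 0 \<le> \<phi> z" for u v s \<phi>
  proof -
    obtain p where p: "awalk u p v" "path_length len p \<le> D" using D * by blast
    have "exp (- s * D) * vgreen s \<phi> u \<le> exp (- s * path_length len p) * vgreen s \<phi> u"
      using p(2) * vgreen_nonneg[of s \<phi> u] by (intro mult_right_mono) (auto intro: mult_left_mono order_trans)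
    also have "\<dots> \<le> vgreen s \<phi> v" using vgreen_awalk[OF p(1) *(3,5,4)] by simp
    finally show ?thesis .
  qed
  then show ?thesis using that D(1) by blast
qed

text \<open>
  The transfer operator is self-adjoint for this symmetric bilinear form, since reversing a path
  without backtracking gives such a path.
\<close>

definition reversal_form :: "real \<Rightarrow> ('e \<Rightarrow> real) \<Rightarrow> ('e \<Rightarrow> real) \<Rightarrow> real" where
  "reversal_form s f g = (\<Sum>a\<in>arcs G. wt s a * f (arev a) * g a)"

lemma bij_betw_arev: "bij_betw arev (arcs G) (arcs G)"
  by (rule permutes_imp_bij[OF arev_permutes_arcs])

lemma reversal_form_commute: "reversal_form s f g = reversal_form s g f"
proof -
  have "reversal_form s f g = (\<Sum>a\<in>arcs G. wt s (arev a) * f (arev (arev a)) * g (arev a))"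
    unfolding reversal_form_def by (rule sum.reindex_bij_betw[OF bij_betw_arev, symmetric])
  also have "\<dots> = reversal_form s g f"
    unfolding reversal_form_def by (intro sum.cong refl) (simp add: wt_arev)
  finally show ?thesis .
qed

lemma transfer_arcs: "transfer s f a = (\<Sum>b\<in>arcs G. if b \<in> succs a then wt s b * f b else 0)"
  unfolding transfer_def using succs_subset[of a] by (simp add: sum.If_cases Int_absorb1)

lemma reversal_form_transfer: "reversal_form s f (transfer s g) = reversal_form s (transfer s f) g"
proof -
  have "reversal_form s (transfer s f) g
      = (\<Sum>b\<in>arcs G. \<Sum>a\<in>arcs G. if a \<in> succs (arev b) then wt s b * wt s a * f a * g b else 0)"
    unfolding reversal_form_def transfer_arcs[of s f]
    by (simp add: sum_distrib_left sum_distrib_right if_distrib if_distribR mult_ac cong: if_cong)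
  \<comment> \<open>Reindexing prepares the reversal: \<open>arev a\<close> follows
    \<open>arev b\<close> exactly if \<open>b\<close> follows \<open>a\<close>.\<close>
  also have "\<dots> = (\<Sum>b\<in>arcs G. \<Sum>a\<in>arcs G. if arev a \<in> succs (arev b)
      then wt s b * wt s (arev a) * f (arev a) * g b else 0)"
    by (rule sum.cong[OF refl]) (rule sum.reindex_bij_betw[OF bij_betw_arev, symmetric])
  also have "\<dots> = (\<Sum>b\<in>arcs G. \<Sum>a\<in>arcs G. if b \<in> succs a
      then wt s b * wt s a * f (arev a) * g b else 0)"
    by (intro sum.cong refl) (simp add: wt_arev succs_arev)
  also have "\<dots> = (\<Sum>a\<in>arcs G. \<Sum>b\<in>arcs G. if b \<in> succs a
      then wt s b * wt s a * f (arev a) * g b else 0)"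
    by (rule sum.swap)
  also have "\<dots> = reversal_form s f (transfer s g)"
    unfolding reversal_form_def transfer_arcs[of s g]
    by (simp add: sum_distrib_left sum_distrib_right if_distrib if_distribR mult_ac cong: if_cong)
  finally show ?thesis by simp
qed

lemma reversal_form_transfer_pow: "reversal_form s f ((transfer s ^^ n) g) = reversal_form s ((transfer s ^^ n) f) g"
proof (induction n arbitrary: f)
  case (Suc n)
  have "reversal_form s f ((transfer s ^^ Suc n) g) = reversal_form s (transfer s f) ((transfer s ^^ n) g)"
    by (simp add: reversal_form_transfer)
  also have "\<dots> = reversal_form s ((transfer s ^^ Suc n) f) g"
    by (subst Suc) (simp add: funpow_swap1)
  finally show ?case .
qed simp

abbreviation ind :: "'v \<Rightarrow> 'v \<Rightarrow> real" where
  "ind v \<equiv> indicator {v}"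

text \<open>Start and end of the walks become the two arguments of a symmetric form, which makes the
  reversal symmetry of \<open>vgreen\<close> visible.\<close>

lemma vgreen_reversal_form:
  assumes "convergent_at s" "\<And>z. z \<in> verts G \<Longrightarrow> 0 \<le> \<phi> z"
  shows "vgreen s \<phi> u = \<phi> u + (\<Sum>n. reversal_form s (\<lambda>b. ind u (head G b))
           ((transfer s ^^ n) (\<lambda>b. \<phi> (head G b))))"
proof -
  let ?f = "\<lambda>b. \<phi> (head G b)"
  have s: "summable (\<lambda>n. (transfer s ^^ n) ?f b)" if "b \<in> arcs G" for b
    using assms that by (intro green_summable) auto
  have "reversal_form s (\<lambda>b. ind u (head G b)) g = (\<Sum>a\<in>out_arcs G u. wt s a * g a)" for g
  proof -
    have "reversal_form s (\<lambda>b. ind u (head G b)) g = (\<Sum>a\<in>arcs G. if a \<in> out_arcs G u then wt s a * g a else 0)"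
      unfolding reversal_form_def by (intro sum.cong refl) (auto simp: indicator_def)
    also have "\<dots> = (\<Sum>a\<in>out_arcs G u. wt s a * g a)"
      by (subst sum.inter_restrict[symmetric]) (auto intro!: sum.cong)
    finally show ?thesis .
  qed
  moreover have "(\<Sum>n. \<Sum>a\<in>out_arcs G u. wt s a * (transfer s ^^ n) ?f a)
      = (\<Sum>a\<in>out_arcs G u. \<Sum>n. wt s a * (transfer s ^^ n) ?f a)"
    by (rule suminf_sum) (intro summable_mult s, simp)
  moreover have "\<dots> = (\<Sum>a\<in>out_arcs G u. wt s a * green s \<phi> a)"
    unfolding green_def by (intro sum.cong refl suminf_mult s) simp
  ultimately show ?thesis by (simp add: vgreen_def)
qed

lemma vgreen_ind_commute:
  assumes "convergent_at s"
  shows "vgreen s (ind v) u = vgreen s (ind u) v"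
proof -
  have "reversal_form s (\<lambda>b. ind u (head G b)) ((transfer s ^^ n) (\<lambda>b. ind v (head G b)))
      = reversal_form s (\<lambda>b. ind v (head G b)) ((transfer s ^^ n) (\<lambda>b. ind u (head G b)))" for n
    by (subst reversal_form_transfer_pow) (rule reversal_form_commute)
  then show ?thesis by (simp add: vgreen_reversal_form[OF assms] indicator_def)
qed

lemma vgreen_add:
  assumes "convergent_at s" "\<And>z. z \<in> verts G \<Longrightarrow> 0 \<le> \<phi> z" "\<And>z. z \<in> verts G \<Longrightarrow> 0 \<le> \<psi> z"
  shows "vgreen s (\<lambda>z. \<phi> z + \<psi> z) u = vgreen s \<phi> u + vgreen s \<psi> u"
  using green_add[OF assms] by (simp add: vgreen_def distrib_left sum.distrib)

lemma green_zero [simp]: "green s (\<lambda>z. 0) a = 0"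
proof -
  have "transfer s (\<lambda>b. 0) = (\<lambda>b. 0)" by (rule ext) simp
  then have "(transfer s ^^ n) (\<lambda>b. 0) = (\<lambda>b. 0)" for n
    by (induction n) simp_all
  then show ?thesis by (simp add: green_def)
qed

lemma vgreen_sum_ind:
  assumes "convergent_at s" "finite S"
  shows "vgreen s (\<lambda>z. \<Sum>v\<in>S. ind v z) u = (\<Sum>v\<in>S. vgreen s (ind v) u)"
  using assms(2)
proof (induction S rule: finite_induct)
  case empty
  then show ?case by (simp add: vgreen_def)
next
  case (insert v S)
  then show ?case
    using vgreen_add[OF assms(1), of "ind v" "\<lambda>z. \<Sum>v\<in>S. ind v z" u] by (simp add: sum_nonneg)
qed

lemma vgreen_cong:
  assumes "convergent_at s" "\<And>z. z \<in> verts G \<Longrightarrow> 0 \<le> \<phi> z" "\<And>z. z \<in> verts G \<Longrightarrow> \<phi> z = \<psi> z"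
    "u \<in> verts G"
  shows "vgreen s \<phi> u = vgreen s \<psi> u"
proof -
  have "green s \<phi> a = green s \<psi> a" if "a \<in> arcs G" for a
    using green_mono[OF assms(1), of \<phi> \<psi> a] green_mono[OF assms(1), of \<psi> \<phi> a] assms that
    by (intro antisym) auto
  then show ?thesis using assms by (simp add: vgreen_def)
qed

text \<open>The Harnack inequality moves the start of a walk; by \<open>vgreen_ind_commute\<close>
  it also moves the end. Summing over all ends gives the walks with free end.\<close>

lemma vgreen_ind_ge:
  assumes "strongly_connected G"
  obtains D where "0 \<le> D"
    "\<And>u v s. u \<in> verts G \<Longrightarrow> v \<in> verts G \<Longrightarrow> convergent_at s \<Longrightarrow> 0 \<le> s \<Longrightarrow>
       exp (- s * D) * vgreen s (\<lambda>_. 1) u \<le> card (verts G) * vgreen s (ind v) u"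
proof -
  obtain D where D: "0 \<le> D"
    "\<And>u v s \<phi>. u \<in> verts G \<Longrightarrow> v \<in> verts G \<Longrightarrow> convergent_at s \<Longrightarrow> 0 \<le> s \<Longrightarrow>
       (\<And>z. z \<in> verts G \<Longrightarrow> 0 \<le> \<phi> z) \<Longrightarrow> exp (- s * D) * vgreen s \<phi> u \<le> vgreen s \<phi> v"
    using vgreen_compare[OF assms] by blast
  have "exp (- s * D) * vgreen s (\<lambda>_. 1) u \<le> card (verts G) * vgreen s (ind v) u"
    if *: "u \<in> verts G" "v \<in> verts G" "convergent_at s" "0 \<le> s" for u v s
  proof -
    have "exp (- s * D) * vgreen s (ind v') u \<le> vgreen s (ind v) u" if "v' \<in> verts G" for v'
      using D(2)[OF that *(2-4), of "ind u"] by (simp add: vgreen_ind_commute[OF *(3), of _ u])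
    then have "(\<Sum>v'\<in>verts G. exp (- s * D) * vgreen s (ind v') u) \<le> card (verts G) * vgreen s (ind v) u"
      by (rule sum_bounded_above)
    moreover have "vgreen s (\<lambda>_. 1) u = (\<Sum>v'\<in>verts G. vgreen s (ind v') u)"
      unfolding vgreen_sum_ind[OF *(3) finite_verts, symmetric]
      using *(1) by (intro vgreen_cong[OF *(3)]) (auto simp: indicator_def)
    ultimately show ?thesis by (simp add: sum_distrib_left)
  qed
  then show ?thesis using that D(1) by blast
qed

section \<open>Reachable arcs and thin arcs\<close>

definition reach :: "'e \<Rightarrow> 'e set" where
  "reach a = {b. (a, b) \<in> {(a, b). b \<in> succs a}\<^sup>*}"

lemma reach_refl: "a \<in> reach a"
  by (simp add: reach_def)

lemma reach_succs: "b \<in> reach a \<Longrightarrow> c \<in> succs b \<Longrightarrow> c \<in> reach a"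
  by (auto simp: reach_def intro: rtrancl_into_rtrancl)

lemma reach_arcs: assumes "a \<in> arcs G" shows "reach a \<subseteq> arcs G"
proof
  fix b assume "b \<in> reach a"
  then have "(a, b) \<in> {(a, b). b \<in> succs a}\<^sup>*" by (simp add: reach_def)
  then show "b \<in> arcs G" by induction (auto simp: assms succs_arcs)
qed

lemma reach_mono: "b \<in> succs a \<Longrightarrow> reach b \<subseteq> reach a"
  by (auto simp: reach_def intro: converse_rtrancl_into_rtrancl)

lemma green_reach:
  assumes "b \<in> reach a" "a \<in> arcs G"
  shows "\<exists>d\<ge>0. \<forall>s. convergent_at s \<longrightarrow> exp (- s * d) * green s (\<lambda>_. 1) b \<le> green s (\<lambda>_. 1) a"
proof -
  have "(a, b) \<in> {(a, b). b \<in> succs a}\<^sup>*" using assms(1) by (simp add: reach_def)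
  then show ?thesis
  proof (induction rule: rtrancl_induct)
    case base
    then show ?case by (intro exI[of _ 0]) auto
  next
    case (step b c)
    then obtain d where d: "d \<ge> 0"
      "\<And>s. convergent_at s \<Longrightarrow> exp (- s * d) * green s (\<lambda>_. 1) b \<le> green s (\<lambda>_. 1) a"
      by blast
    have b: "b \<in> arcs G" using step reach_arcs[OF assms(2)] by (auto simp: reach_def)
    have c: "c \<in> succs b" "c \<in> arcs G" using step succs_arcs by auto
    have "exp (- s * (d + len c)) * green s (\<lambda>_. 1) c \<le> green s (\<lambda>_. 1) a" if s: "convergent_at s" for s
    proof -
      have "exp (- s * (d + len c)) * green s (\<lambda>_. 1) c
          = exp (- s * d) * (wt s c * green s (\<lambda>_. 1) c)"
        by (simp add: wt_def distrib_left exp_add exp_diff exp_minus field_simps)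
      also have "wt s c * green s (\<lambda>_. 1) c \<le> transfer s (green s (\<lambda>_. 1)) b"
        unfolding transfer_def using c(1) s
        by (intro member_le_sum) (auto intro!: green_nonneg mult_nonneg_nonneg dest: succs_arcs)
      also have "\<dots> \<le> green s (\<lambda>_. 1) b"
        using green_eq[OF s, of "\<lambda>_. 1" b] b by simp
      also have "exp (- s * d) * green s (\<lambda>_. 1) b \<le> green s (\<lambda>_. 1) a"
        using d(2)[OF s] .
      finally show ?thesis by simp
    qed
    then show ?case using d(1) len_pos[OF c(2)] by (intro exI[of _ "d + len c"]) auto
  qed
qed

text \<open>Examples are an arc that points into a hanging tree and the arcs of a graph that is a
  single circle: from there on no edge can be traversed in both directions.\<close>

definition thin :: "'e \<Rightarrow> bool" where
  "thin a \<longleftrightarrow> (\<forall>b\<in>reach a. arev b \<notin> reach a)"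

lemma thin_succs: "thin a \<Longrightarrow> b \<in> succs a \<Longrightarrow> thin b"
  using reach_mono unfolding thin_def by blast

text \<open>
  If \<open>a\<close> is thin, an arc in \<open>reach a\<close> has at most one predecessor in \<open>reach a\<close>: for two
  predecessors \<open>b\<close>, \<open>b'\<close>, the arc \<open>arev b'\<close> could follow \<open>b\<close>. So the transfer operator contracts
  the sum over \<open>reach a\<close>.
\<close>

lemma thin_transfer:
  assumes "thin a" "a \<in> arcs G" "0 \<le> s" "\<And>b. b \<in> arcs G \<Longrightarrow> 0 \<le> f b"
  shows "(\<Sum>b\<in>reach a. transfer s f b) \<le> exp (- s * min_len) * (\<Sum>b\<in>reach a. f b)"
proof -
  let ?R = "reach a"
  have R: "?R \<subseteq> arcs G" using reach_arcs[OF assms(2)] .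
  have fin: "finite ?R" using finite_subset[OF R finite_arcs] .
  have uniq: "b = b'" if "b \<in> ?R" "b' \<in> ?R" "c \<in> succs b" "c \<in> succs b'" for b b' c
  proof (rule ccontr)
    assume "b \<noteq> b'"
    have "b \<in> arcs G" "b' \<in> arcs G" using R that by auto
    then have "arev b' \<in> succs b"
      using that \<open>b \<noteq> b'\<close> by (auto simp: succs_def arev_eq_iff)
    then have "arev b' \<in> ?R" using that reach_succs by blast
    then show False using assms(1) that(2) unfolding thin_def by blast
  qed
  have "(\<Sum>b\<in>?R. transfer s f b) = (\<Sum>(b, c)\<in>Sigma ?R succs. wt s c * f c)"
    unfolding transfer_def using fin by (subst sum.Sigma) auto
  also have "\<dots> = (\<Sum>c\<in>snd ` Sigma ?R succs. wt s c * f c)"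
    by (subst sum.reindex) (auto simp: inj_on_def case_prod_unfold intro: uniq)
  also have "\<dots> \<le> (\<Sum>c\<in>?R. wt s c * f c)"
    using fin R assms(4) by (intro sum_mono2) (auto intro: reach_succs)
  also have "\<dots> \<le> (\<Sum>c\<in>?R. exp (- s * min_len) * f c)"
  proof (intro sum_mono mult_right_mono)
    fix c assume "c \<in> ?R"
    then have c: "c \<in> arcs G" using R by auto
    show "0 \<le> f c" using assms(4)[OF c] .
    show "wt s c \<le> exp (- s * min_len)"
      unfolding wt_def using min_len_le[OF c] assms(3) by (auto intro: mult_left_mono)
  qed
  finally show ?thesis by (simp add: sum_distrib_left)
qed

text \<open>Iterating \<open>thin_transfer\<close> gives geometric decay with ratio
  \<open>exp (- s * min_len)\<close>. The bound stays finite as \<open>s\<close> decreases to a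
  positive \<open>crit\<close>.\<close>

lemma green_thin:
  assumes "thin a" "a \<in> arcs G" "0 < s"
  shows "green s (\<lambda>_. 1) a \<le> card (arcs G) / (1 - exp (- s * min_len))"
proof -
  let ?R = "reach a" and ?\<theta> = "exp (- s * min_len)"
  have R: "?R \<subseteq> arcs G" using reach_arcs[OF assms(2)] .
  have fin: "finite ?R" using finite_subset[OF R finite_arcs] .
  have \<theta>: "0 < ?\<theta>" "?\<theta> < 1" using assms(3) min_len_pos by auto
  have nonneg: "0 \<le> (transfer s ^^ n) (\<lambda>_. 1) b" if "b \<in> arcs G" for n b
    using that by (intro transfer_pow_nonneg) auto
  have "(\<Sum>b\<in>?R. (transfer s ^^ n) (\<lambda>_. 1) b) \<le> ?\<theta> ^ n * card ?R" for n
  proof (induction n)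
    case (Suc n)
    have "(\<Sum>b\<in>?R. (transfer s ^^ Suc n) (\<lambda>_. 1) b) \<le> ?\<theta> * (\<Sum>b\<in>?R. (transfer s ^^ n) (\<lambda>_. 1) b)"
      using thin_transfer[OF assms(1,2), of s "(transfer s ^^ n) (\<lambda>_. 1)"] nonneg assms(3) by simp
    also have "\<dots> \<le> ?\<theta> * (?\<theta> ^ n * card ?R)" using Suc \<theta> by (intro mult_left_mono) auto
    finally show ?case by simp
  qed simp
  moreover have "(transfer s ^^ n) (\<lambda>_. 1) a \<le> (\<Sum>b\<in>?R. (transfer s ^^ n) (\<lambda>_. 1) b)" for n
    using R nonneg fin reach_refl by (intro member_le_sum) auto
  moreover have "?\<theta> ^ n * card ?R \<le> ?\<theta> ^ n * card (arcs G)" for n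
    using \<theta> R by (intro mult_left_mono) (auto intro: card_mono)
  ultimately have *: "(transfer s ^^ n) (\<lambda>_. 1) a \<le> ?\<theta> ^ n * card (arcs G)" for n
    by (meson order_trans)
  have summ: "summable (\<lambda>n. ?\<theta> ^ n * card (arcs G))"
    using \<theta> by (intro summable_mult2 summable_geometric) auto
  have "green s (\<lambda>_. 1) a \<le> (\<Sum>n. ?\<theta> ^ n * card (arcs G))"
    unfolding green_def
  proof (rule suminf_le[OF * _ summ])
    show "summable (\<lambda>n. (transfer s ^^ n) (\<lambda>_. 1) a)"
      by (rule summable_comparison_test'[OF summ, of 0]) (use * nonneg[OF assms(2)] in auto)
  qed
  also have "\<dots> = (\<Sum>n. ?\<theta> ^ n) * card (arcs G)"
    using \<theta> by (intro suminf_mult2[symmetric] summable_geometric) auto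
  also have "(\<Sum>n. ?\<theta> ^ n) = 1 / (1 - ?\<theta>)"
    using \<theta> by (intro suminf_geometric) auto
  finally show ?thesis by simp
qed

text \<open>By \<open>vgreen_head\<close> the walks from \<open>head G b\<close> are distributed
  over \<open>b\<close> and \<open>arev b\<close>. If both are reachable from \<open>a\<close>, the
  Green function at \<open>a\<close> dominates this vertex sum up to constants, with the 2 for the
  two summands; the Harnack inequality passes on to \<open>v\<close>.\<close>

lemma green_not_thin:
  assumes "strongly_connected G" "a \<in> arcs G" "\<not> thin a"
  shows "\<exists>d\<ge>0. \<forall>s v. convergent_at s \<longrightarrow> 0 \<le> s \<longrightarrow> v \<in> verts G \<longrightarrow>
    exp (- s * d) / 2 * vgreen s (\<lambda>_. 1) v \<le> green s (\<lambda>_. 1) a"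
proof -
  obtain b where b: "b \<in> reach a" "arev b \<in> reach a"
    using assms(3) by (auto simp: thin_def)
  have b': "b \<in> arcs G" using b(1) reach_arcs[OF assms(2)] by auto
  obtain D where D: "0 \<le> D"
    "\<And>u v s \<phi>. u \<in> verts G \<Longrightarrow> v \<in> verts G \<Longrightarrow> convergent_at s \<Longrightarrow> 0 \<le> s \<Longrightarrow>
       (\<And>z. z \<in> verts G \<Longrightarrow> 0 \<le> \<phi> z) \<Longrightarrow> exp (- s * D) * vgreen s \<phi> u \<le> vgreen s \<phi> v"
    using vgreen_compare[OF assms(1)] by blast
  obtain d1 where d1: "d1 \<ge> 0"
    "\<And>s. convergent_at s \<Longrightarrow> exp (- s * d1) * green s (\<lambda>_. 1) b \<le> green s (\<lambda>_. 1) a"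
    using green_reach[OF b(1) assms(2)] by blast
  obtain d2 where d2: "d2 \<ge> 0"
    "\<And>s. convergent_at s \<Longrightarrow> exp (- s * d2) * green s (\<lambda>_. 1) (arev b) \<le> green s (\<lambda>_. 1) a"
    using green_reach[OF b(2) assms(2)] by blast
  have "exp (- s * (D + d1 + d2)) / 2 * vgreen s (\<lambda>_. 1) v \<le> green s (\<lambda>_. 1) a"
    if s: "convergent_at s" "0 \<le> s" and v: "v \<in> verts G" for s v
  proof -
    let ?g = "green s (\<lambda>_. 1)"
    have nonneg: "0 \<le> ?g c" if "c \<in> arcs G" for c
      using s(1) that by (intro green_nonneg) auto
    have "exp (- s * (d1 + d2)) * ?g b \<le> exp (- s * d1) * ?g b"
      using d2(1) s(2) nonneg[OF b'] by (intro mult_right_mono) (auto intro: mult_left_mono)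
    then have 1: "exp (- s * (d1 + d2)) * ?g b \<le> ?g a" using d1(2)[OF s(1)] by linarith
    have "wt s b * ?g (arev b) \<le> 1 * ?g (arev b)"
      using wt_le_1[OF s(2) b'] nonneg b' by (intro mult_right_mono) auto
    then have "exp (- s * (d1 + d2)) * (wt s b * ?g (arev b)) \<le> exp (- s * d2) * ?g (arev b)"
      using d1(1) s(2) nonneg b' by (intro mult_mono) (auto intro: mult_left_mono)
    then have 2: "exp (- s * (d1 + d2)) * (wt s b * ?g (arev b)) \<le> ?g a" using d2(2)[OF s(1)] by linarith
    have "exp (- s * D) * vgreen s (\<lambda>_. 1) v \<le> vgreen s (\<lambda>_. 1) (head G b)"
      using D(2)[OF v _ s] b' by simp
    also have "\<dots> = ?g b + wt s b * ?g (arev b)"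
      using vgreen_head[OF s(1) _ b'] by simp
    finally have "exp (- s * (d1 + d2)) * (exp (- s * D) * vgreen s (\<lambda>_. 1) v)
        \<le> exp (- s * (d1 + d2)) * (?g b + wt s b * ?g (arev b))"
      by (intro mult_left_mono) auto
    moreover have "exp (- s * (d1 + d2)) * exp (- s * D) = exp (- s * (D + d1 + d2))"
      by (simp add: exp_add[symmetric] algebra_simps)
    ultimately have "exp (- s * (D + d1 + d2)) * vgreen s (\<lambda>_. 1) v \<le> 2 * ?g a"
      using 1 2 by (simp only: mult.assoc[symmetric]) (simp add: distrib_left)
    then show ?thesis by simp
  qed
  then show ?thesis using D(1) d1(1) d2(1) by (intro exI[of _ "D + d1 + d2"]) auto
qed

section \<open>Counting walks\<close>

text \<open>
  If the Green function at \<open>crit + e\<close> were smaller than \<open>c / e\<close>, twice this function would be a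
  supersolution at \<open>crit - e\<close>.
\<close>

lemma green_pole_lower:
  assumes "0 < crit"
  obtains c \<epsilon> where "0 < c" "0 < \<epsilon>"
    "\<And>s. crit < s \<Longrightarrow> s < crit + \<epsilon> \<Longrightarrow> \<exists>a\<in>arcs G. c / (s - crit) \<le> green s (\<lambda>_. 1) a"
proof
  \<comment> \<open>Passing from \<open>crit + e\<close> to \<open>crit - e\<close> multiplies the
    weights by at most \<open>exp (2 * e * max_len)\<close>, hence by
    \<open>1 + 4 * e * max_len\<close>. On a Green function below \<open>c / e\<close> this costs at
    most \<open>4 * max_len * c = 1 / 2\<close>, and doubling restores the source 1. The bound
    \<open>e < crit\<close> keeps the new exponent positive, as \<open>crit\<close>
    requires.\<close>
  define c where "c = 1 / (8 * max_len)"
  define \<epsilon> where "\<epsilon> = min crit (1 / (2 * max_len))"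
  note L = max_len_pos
  show "0 < c" "0 < \<epsilon>" using L assms by (auto simp: c_def \<epsilon>_def)
  fix s assume s: "crit < s" "s < crit + \<epsilon>"
  define e where "e = s - crit"
  have e: "0 < e" "e < crit" "e \<le> 1 / (2 * max_len)"
    using s by (auto simp: e_def \<epsilon>_def)
  then have e': "2 * e * max_len \<le> 1" using L by (simp add: field_simps)
  let ?g = "green s (\<lambda>_. 1)"
  have conv: "convergent_at s" using convergent_above_crit s by blast
  show "\<exists>a\<in>arcs G. c / (s - crit) \<le> ?g a"
  proof (rule ccontr)
    assume "\<not> ?thesis"
    then have small: "?g a < c / e" if "a \<in> arcs G" for a using that by (force simp: e_def)
    have g: "0 \<le> ?g a" if "a \<in> arcs G" for a using conv that by (intro green_nonneg) auto
    have "0 \<le> 2 * ?g a \<and> 1 + transfer (crit - e) (\<lambda>b. 2 * ?g b) a \<le> 2 * ?g a" if a: "a \<in> arcs G" for a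
    proof
      show "0 \<le> 2 * ?g a" using g[OF a] by simp
      have eq: "?g a = 1 + transfer s ?g a" using green_eq[OF conv, of "\<lambda>_. 1" a] a by simp
      have pos: "0 \<le> transfer s ?g a" using g by (rule transfer_nonneg)
      have "transfer (crit - e) ?g a \<le> exp (2 * e * max_len) * transfer s ?g a"
        unfolding transfer_def sum_distrib_left
      proof (intro sum_mono)
        fix b assume "b \<in> succs a"
        then have b: "b \<in> arcs G" by (rule succs_arcs)
        have "wt (crit - e) b = exp (2 * e * len b) * wt s b"
          by (simp add: wt_def e_def exp_add[symmetric] algebra_simps)
        also have "\<dots> \<le> exp (2 * e * max_len) * wt s b"
          using max_len_ge[OF b] e by (intro mult_right_mono) auto
        finally show "wt (crit - e) b * ?g b \<le> exp (2 * e * max_len) * (wt s b * ?g b)"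
          using g[OF b] by (simp add: mult.assoc[symmetric] mult_right_mono)
      qed
      also have "\<dots> \<le> (1 + 4 * e * max_len) * transfer s ?g a"
      proof (intro mult_right_mono pos)
        have "exp (2 * e * max_len) \<le> 1 + 2 * e * max_len + (2 * e * max_len)\<^sup>2"
          using e e' L by (intro exp_bound) auto
        moreover have "(2 * e * max_len)\<^sup>2 \<le> 2 * e * max_len"
          using e e' L by (simp add: power2_eq_square mult_left_le)
        ultimately show "exp (2 * e * max_len) \<le> 1 + 4 * e * max_len" by simp
      qed
      also have "\<dots> \<le> transfer s ?g a + 1 / 2"
      proof -
        have "transfer s ?g a \<le> c / e" using small[OF a] eq by simp
        then have "4 * e * max_len * transfer s ?g a \<le> 4 * e * max_len * (c / e)"
          using e L by (intro mult_left_mono) auto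
        also have "\<dots> = 1 / 2" using e L by (simp add: c_def)
        finally show ?thesis by (simp add: distrib_right)
      qed
      finally have "transfer (crit - e) ?g a \<le> ?g a - 1 / 2" using eq by simp
      then show "1 + transfer (crit - e) (\<lambda>b. 2 * ?g b) a \<le> 2 * ?g a"
        by (simp add: transfer_cmult)
    qed
    then have "convergent_at (crit - e)"
      unfolding convergent_at_def by (intro exI[of _ "\<lambda>a. 2 * ?g a"] ballI)
    then have "crit \<le> crit - e" using e by (intro crit_le) auto
    then show False using e by simp
  qed
qed

definition walks_from :: "'e \<Rightarrow> real \<Rightarrow> 'e list set" where
  "walks_from a r = {q. successively (\<lambda>b c. c \<in> succs b) (a # q) \<and> path_length len q \<le> r}"

definition walk_count :: "'e \<Rightarrow> real \<Rightarrow> real" where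
  "walk_count a r = card (walks_from a r)"

text \<open>Every arc uses up at least \<open>min_len\<close> of the length budget \<open>r\<close>,
  so it becomes negative after finitely many steps.\<close>

lemma walk_length_induct [consumes 1, case_names neg step]:
  assumes "a \<in> arcs G"
    and neg: "\<And>a r. a \<in> arcs G \<Longrightarrow> r < 0 \<Longrightarrow> P a r"
    and step: "\<And>a r. a \<in> arcs G \<Longrightarrow> 0 \<le> r \<Longrightarrow> (\<And>b. b \<in> succs a \<Longrightarrow> P b (r - len b)) \<Longrightarrow> P a r"
  shows "P a r"
proof -
  have "P a r" if "a \<in> arcs G" "r < real n * min_len" for n a r
    using that
  proof (induction n arbitrary: a r)
    case 0
    then show ?case using neg by simp
  next
    case (Suc n)
    show ?case
    proof (cases "r < 0")
      case False
      show ?thesis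
      proof (rule step[OF Suc.prems(1)])
        fix b assume "b \<in> succs a"
        then have b: "b \<in> arcs G" by (rule succs_arcs)
        then show "P b (r - len b)"
          using Suc.prems(2) min_len_le[OF b] by (intro Suc.IH) (auto simp: algebra_simps)
      qed (use False in simp)
    qed (use neg Suc.prems in simp)
  qed
  moreover obtain n where "r / min_len < real n" using reals_Archimedean2 by blast
  ultimately show ?thesis using assms(1) min_len_pos by (simp add: divide_less_eq)
qed

lemma successively_succs_arcs:
  "successively (\<lambda>b c. c \<in> succs b) (a # q) \<Longrightarrow> set q \<subseteq> arcs G"
  by (induction q arbitrary: a) (auto dest: succs_arcs)

lemma walks_from_neg: "r < 0 \<Longrightarrow> walks_from a r = {}"
  using successively_succs_arcs path_length_nonneg unfolding walks_from_def by fastforce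

lemma walks_from_rec:
  assumes "0 \<le> r"
  shows "walks_from a r = insert [] (\<Union>b\<in>succs a. (#) b ` walks_from b (r - len b))"
proof (intro set_eqI)
  fix q
  show "q \<in> walks_from a r \<longleftrightarrow> q \<in> insert [] (\<Union>b\<in>succs a. (#) b ` walks_from b (r - len b))"
    using assms by (cases q) (auto simp: walks_from_def path_length_def image_iff algebra_simps)
qed

lemma finite_walks_from:
  assumes "a \<in> arcs G" shows "finite (walks_from a r)"
  using assms by (induction a r rule: walk_length_induct) (simp_all add: walks_from_neg walks_from_rec)

lemma walk_count_neg: "r < 0 \<Longrightarrow> walk_count a r = 0"
  by (simp add: walk_count_def walks_from_neg)

lemma card_Cons_UN:
  assumes "finite B" "\<And>b. b \<in> B \<Longrightarrow> finite (W b)"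
  shows "card (insert [] (\<Union>b\<in>B. (#) b ` W b)) = 1 + (\<Sum>b\<in>B. card (W b))"
proof -
  have "card (\<Union>b\<in>B. (#) b ` W b) = (\<Sum>b\<in>B. card ((#) b ` W b))"
    using assms by (intro card_UN_disjoint) auto
  moreover have "[] \<notin> (\<Union>b\<in>B. (#) b ` W b)" by auto
  moreover have "card ((#) b ` W b) = card (W b)" for b by (simp add: card_image)
  ultimately show ?thesis using assms by simp
qed

lemma walk_count_rec:
  assumes "0 \<le> r"
  shows "walk_count a r = 1 + (\<Sum>b\<in>succs a. walk_count b (r - len b))"
  unfolding walk_count_def walks_from_rec[OF assms]
  by (subst card_Cons_UN) (auto intro: finite_walks_from dest: succs_arcs)

lemma walk_count_nonneg: "0 \<le> walk_count a r"
  by (simp add: walk_count_def)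

lemma walk_count_mono:
  assumes "a \<in> arcs G" "r \<le> r'" shows "walk_count a r \<le> walk_count a r'"
proof -
  have "walks_from a r \<subseteq> walks_from a r'" using assms(2) by (auto simp: walks_from_def)
  then show ?thesis
    unfolding walk_count_def by (intro of_nat_mono card_mono finite_walks_from assms(1))
qed

text \<open>The right-hand side solves the recursion of \<open>walk_count\<close> with the source
  \<open>exp (s * r)\<close>, which is at least 1 for \<open>r \<ge> 0\<close>, in place of
  1.\<close>

lemma walk_count_le:
  assumes "a \<in> arcs G" "convergent_at s" "0 \<le> s"
  shows "walk_count a r \<le> green s (\<lambda>_. 1) a * exp (s * r)"
  using assms(1)
proof (induction a r rule: walk_length_induct)
  case (neg a r)
  then show ?case using green_nonneg[OF assms(2), of "\<lambda>_. 1" a] by (simp add: walk_count_neg)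
next
  case (step a r)
  have "walk_count a r \<le> exp (s * r) + (\<Sum>b\<in>succs a. green s (\<lambda>_. 1) b * exp (s * (r - len b)))"
    using step assms(3) by (simp add: walk_count_rec add_mono sum_mono)
  also have "\<dots> = exp (s * r) * (1 + transfer s (green s (\<lambda>_. 1)) a)"
    by (simp add: transfer_def wt_def distrib_left sum_distrib_left exp_diff exp_minus field_simps)
  also have "\<dots> = green s (\<lambda>_. 1) a * exp (s * r)"
    using green_eq[OF assms(2), of "\<lambda>_. 1" a] step(1) by simp
  finally show ?case .
qed

text \<open>For \<open>r\<close> up to \<open>R\<close> the left-hand side solves the recursion with
  the source \<open>exp (s * (r - max_len)) / m\<close>, which is at most 1 by
  \<open>exp (s * R) \<le> m\<close>. The shift by \<open>max_len\<close> keeps it below the count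
  for short walks.\<close>

lemma walk_count_ge:
  assumes "a \<in> arcs G" "convergent_at s" "0 \<le> s" "0 < m" "exp (s * R) \<le> m"
    and m: "\<And>b. b \<in> arcs G \<Longrightarrow> green s (\<lambda>_. 1) b \<le> m"
  shows "0 \<le> r \<Longrightarrow> r \<le> R \<Longrightarrow> green s (\<lambda>_. 1) a / m * exp (s * (r - max_len)) \<le> walk_count a r"
  using assms(1)
proof (induction a r rule: walk_length_induct)
  case (neg a r)
  then show ?case by simp
next
  case (step a r)
  let ?g = "green s (\<lambda>_. 1)" and ?k = "exp (s * (r - max_len)) / m"
  have g: "0 \<le> ?g b" if "b \<in> arcs G" for b using assms(2) that by (intro green_nonneg) auto
  have rec: "walk_count a r = 1 + (\<Sum>b\<in>succs a. walk_count b (r - len b))"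
    using step(2) by (rule walk_count_rec)
  have nn: "0 \<le> (\<Sum>b\<in>succs a. walk_count b (r - len b))"
    by (intro sum_nonneg walk_count_nonneg)
  show ?case
  \<comment> \<open>Here the empty walk alone suffices. Beyond \<open>max_len\<close> every
    \<open>r - len b\<close> is still nonnegative, so that the induction hypothesis applies.\<close>
  proof (cases "r \<le> max_len")
    case True
    then have "exp (s * (r - max_len)) \<le> 1" using assms(3) by (simp add: mult_nonneg_nonpos)
    moreover have "?g a / m \<le> 1" using m[OF step(1)] assms(4) by simp
    ultimately have "?g a / m * exp (s * (r - max_len)) \<le> 1 * 1"
      using g[OF step(1)] assms(4) by (intro mult_mono) auto
    then show ?thesis using rec nn by simp
  next
    case False
    have k: "?k \<le> 1"
    proof -
      have "exp (s * (r - max_len)) \<le> exp (s * R)"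
        using step(5) max_len_pos assms(3) by (auto intro: mult_left_mono)
      also have "\<dots> \<le> m" by (rule assms(5))
      finally show ?thesis using assms(4) by simp
    qed
    have "?k * transfer s ?g a = (\<Sum>b\<in>succs a. ?g b / m * exp (s * (r - len b - max_len)))"
      unfolding transfer_def wt_def sum_distrib_left
      by (intro sum.cong refl) (simp add: algebra_simps exp_add exp_diff exp_minus divide_simps)
    also have "\<dots> \<le> (\<Sum>b\<in>succs a. walk_count b (r - len b))"
    proof (intro sum_mono)
      fix b assume b: "b \<in> succs a"
      have b': "b \<in> arcs G" using b by (rule succs_arcs)
      show "?g b / m * exp (s * (r - len b - max_len)) \<le> walk_count b (r - len b)"
        using False max_len_ge[OF b'] len_pos[OF b'] step(5) by (intro step(3) b) auto
    qed
    finally have "1 + ?k * transfer s ?g a \<le> walk_count a r" using rec by simp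
    moreover have "?g a = 1 + transfer s ?g a"
      using green_eq[OF assms(2), of "\<lambda>_. 1" a] step(1) by simp
    ultimately show ?thesis using k by (simp add: distrib_left mult.commute add_divide_distrib)
  qed
qed

text \<open>The exponent \<open>s\<close> is chosen after \<open>r\<close>, so close to
  \<open>crit\<close> that the largest Green value is at least \<open>exp (s * r)\<close>; the arc
  where it is attained loses no factor. This yields the exact exponent \<open>crit\<close>, at an
  arc that may depend on \<open>r\<close>.\<close>

lemma walk_count_ge_crit:
  assumes "0 < crit" "max_len \<le> r"
  shows "\<exists>a\<in>arcs G. exp (crit * (r - max_len)) \<le> walk_count a r"
proof -
  obtain c \<epsilon> where c: "0 < c" "0 < \<epsilon>"
    "\<And>s. crit < s \<Longrightarrow> s < crit + \<epsilon> \<Longrightarrow> \<exists>a\<in>arcs G. c / (s - crit) \<le> green s (\<lambda>_. 1) a"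
    using green_pole_lower[OF assms(1)] by metis
  define e where "e = min (min (\<epsilon> / 2) 1) (c / exp ((crit + 1) * r))"
  have e: "0 < e" "e < \<epsilon>" "e \<le> 1" "e \<le> c / exp ((crit + 1) * r)"
    using c by (auto simp: e_def)
  define s where "s = crit + e"
  have s: "crit < s" "s < crit + \<epsilon>" "s \<le> crit + 1" "0 \<le> s" using e assms(1) by (auto simp: s_def)
  have conv: "convergent_at s" using convergent_above_crit s by blast
  let ?g = "green s (\<lambda>_. 1)"
  obtain a0 where a0: "a0 \<in> arcs G" "c / (s - crit) \<le> ?g a0" using c(3)[OF s(1,2)] by blast
  define m where "m = Max (?g ` arcs G)"
  have m: "?g b \<le> m" if "b \<in> arcs G" for b
    unfolding m_def using that by (intro Max_ge) auto
  have "m \<in> ?g ` arcs G" unfolding m_def using a0 by (intro Max_in) auto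
  then obtain a where a: "a \<in> arcs G" "?g a = m" by auto
  have "exp (s * r) \<le> exp ((crit + 1) * r)"
    using s assms max_len_pos by (auto intro: mult_right_mono)
  also have "\<dots> \<le> c / e" using e by (simp add: field_simps)
  also have "\<dots> \<le> m" using a0 m[OF a0(1)] by (simp add: s_def)
  finally have R: "exp (s * r) \<le> m" .
  have "0 < m" using R exp_gt_zero[of "s * r"] by linarith
  have "exp (crit * (r - max_len)) \<le> exp (s * (r - max_len))"
    using s assms by (auto intro: mult_right_mono)
  also have "\<dots> \<le> walk_count a r"
    using walk_count_ge[OF a(1) conv s(4) \<open>0 < m\<close> R m, of r] a(2) \<open>0 < m\<close> assms max_len_pos by simp
  finally show ?thesis using a by blast
qed

section \<open>Counting walks from a vertex\<close>

text \<open>By \<open>cover_dist\<close> these are the vertices of the universal cover at distance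
  at most \<open>r\<close> from its base point.\<close>

definition vwalks :: "'v \<Rightarrow> real \<Rightarrow> 'e list set" where
  "vwalks z r = {p. no_backtracking arev p \<and> (\<exists>u. awalk z p u) \<and> path_length len p \<le> r}"

definition vcount :: "'v \<Rightarrow> real \<Rightarrow> real" where
  "vcount z r = card (vwalks z r)"

lemma no_backtracking_awalk_Cons_iff:
  assumes "z \<in> verts G"
  shows "no_backtracking arev (a # q) \<and> (\<exists>u. awalk z (a # q) u)
    \<longleftrightarrow> a \<in> out_arcs G z \<and> successively (\<lambda>b c. c \<in> succs b) (a # q)"
  using assms
proof (induction q arbitrary: a z)
  case Nil
  then show ?case by (auto simp: no_backtracking_def awalk_simps)
next
  case (Cons b q)
  show ?case
  proof (cases "a \<in> arcs G \<and> tail G a = z")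
    case True
    then show ?thesis
      using Cons.IH[of "head G a" b] by (auto simp: no_backtracking_def awalk_Cons_iff[of z a] succs_def)
  qed (auto simp: awalk_Cons_iff)
qed

lemma vwalks_neg: "r < 0 \<Longrightarrow> vwalks z r = {}"
  using path_length_nonneg unfolding vwalks_def awalk_def by fastforce

lemma vwalks_rec:
  assumes "0 \<le> r" "z \<in> verts G"
  shows "vwalks z r = insert [] (\<Union>a\<in>out_arcs G z. (#) a ` walks_from a (r - len a))"
proof (intro set_eqI)
  fix p
  show "p \<in> vwalks z r \<longleftrightarrow> p \<in> insert [] (\<Union>a\<in>out_arcs G z. (#) a ` walks_from a (r - len a))"
  proof (cases p)
    case Nil
    then show ?thesis using assms by (auto simp: vwalks_def no_backtracking_def path_length_def awalk_Nil_iff)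
  next
    case (Cons a q)
    then show ?thesis using no_backtracking_awalk_Cons_iff[OF assms(2), of a q]
      by (auto simp: vwalks_def walks_from_def path_length_def image_iff algebra_simps)
  qed
qed

lemma finite_vwalks:
  assumes "z \<in> verts G" shows "finite (vwalks z r)"
  using assms finite_walks_from by (cases "r < 0") (simp_all add: vwalks_neg vwalks_rec)

lemma vcount_neg: "r < 0 \<Longrightarrow> vcount z r = 0"
  by (simp add: vcount_def vwalks_neg)

lemma vcount_rec:
  assumes "0 \<le> r" "z \<in> verts G"
  shows "vcount z r = 1 + (\<Sum>a\<in>out_arcs G z. walk_count a (r - len a))"
  unfolding vcount_def walk_count_def vwalks_rec[OF assms]
  by (subst card_Cons_UN) (auto intro: finite_walks_from)

lemma vcount_mono:
  assumes "z \<in> verts G" "r \<le> r'" shows "vcount z r \<le> vcount z r'"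
proof -
  have "vwalks z r \<subseteq> vwalks z r'" using assms(2) by (auto simp: vwalks_def)
  then show ?thesis
    unfolding vcount_def by (intro of_nat_mono card_mono finite_vwalks assms(1))
qed

lemma vcount_head:
  assumes "b \<in> arcs G"
  shows "vcount (head G b) r = walk_count b r + walk_count (arev b) (r - len b)"
proof (cases "r < 0")
  case True
  then show ?thesis using len_pos[OF assms] by (simp add: vcount_neg walk_count_neg)
next
  case False
  then show ?thesis
    using assms out_arcs_head[OF assms] by (simp add: vcount_rec walk_count_rec[of r b] len_arev)
qed

text \<open>The counting form of \<open>vgreen_arc\<close>; monotonicity in \<open>r\<close>
  replaces the bound on the squared weight.\<close>

lemma vcount_arc:
  assumes "b \<in> arcs G" shows "vcount (head G b) (r - len b) \<le> vcount (tail G b) r"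
proof -
  have "walk_count (arev b) (r - len b - len b) \<le> walk_count (arev b) r"
    using assms len_pos[OF assms] by (intro walk_count_mono) auto
  moreover have "vcount (tail G b) r = walk_count (arev b) r + walk_count b (r - len b)"
    using vcount_head[of "arev b" r] assms by (simp add: len_arev)
  ultimately show ?thesis using vcount_head[OF assms, of "r - len b"] by simp
qed

lemma vcount_awalk:
  assumes "awalk u p v" shows "vcount v (r - path_length len p) \<le> vcount u r"
  using assms
proof (induction p arbitrary: u r)
  case Nil
  then show ?case by (simp add: awalk_Nil_iff path_length_def)
next
  case (Cons b p)
  have b: "b \<in> arcs G" "tail G b = u" "awalk (head G b) p v"
    using Cons.prems by (auto simp: awalk_Cons_iff)
  show ?case
    using Cons.IH[OF b(3), of "r - len b"] vcount_arc[OF b(1), of r] b(2)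
    by (simp add: path_length_def algebra_simps)
qed

lemma vcount_le:
  assumes "z \<in> verts G" "convergent_at s" "0 \<le> s"
  shows "vcount z r \<le> vgreen s (\<lambda>_. 1) z * exp (s * r)"
proof (cases "r < 0")
  case True
  then show ?thesis using vgreen_nonneg[OF assms(2) _ assms(1), of "\<lambda>_. 1"] by (simp add: vcount_neg)
next
  case False
  have "vcount z r \<le> exp (s * r) + (\<Sum>a\<in>out_arcs G z. green s (\<lambda>_. 1) a * exp (s * (r - len a)))"
    unfolding vcount_rec[OF leI[OF False] assms(1)]
    using False assms walk_count_le[OF _ assms(2,3)] by (intro add_mono sum_mono) auto
  also have "\<dots> = vgreen s (\<lambda>_. 1) z * exp (s * r)"
    by (simp add: vgreen_def wt_def distrib_left sum_distrib_left exp_diff exp_minus field_simps)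
  finally show ?thesis .
qed

text \<open>The arc in \<open>walk_count_ge_crit\<close> varies with \<open>r\<close>; a connecting
  path of length at most \<open>D\<close> carries its walks over to \<open>z\<close>. If
  \<open>crit = 0\<close>, the empty walk is enough.\<close>

lemma vcount_ge:
  assumes "strongly_connected G"
  obtains D where "\<And>z r. z \<in> verts G \<Longrightarrow> D \<le> r \<Longrightarrow> exp (crit * (r - D)) \<le> vcount z r"
proof -
  obtain D where D: "0 \<le> D"
    "\<And>u v. u \<in> verts G \<Longrightarrow> v \<in> verts G \<Longrightarrow> \<exists>p. awalk u p v \<and> path_length len p \<le> D"
    using strongly_connected_diameter[OF assms] by blast
  have "exp (crit * (r - (D + max_len))) \<le> vcount z r" if z: "z \<in> verts G" and r: "D + max_len \<le> r" for z r
  proof (cases "0 < crit")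
    case True
    obtain a where a: "a \<in> arcs G" "exp (crit * (r - D - max_len)) \<le> walk_count a (r - D)"
      using walk_count_ge_crit[OF True, of "r - D"] r by auto
    obtain p where p: "awalk z p (head G a)" "path_length len p \<le> D"
      using D(2)[OF z, of "head G a"] a(1) by auto
    have "walk_count a (r - D) \<le> vcount (head G a) (r - D)"
      using vcount_head[OF a(1)] walk_count_nonneg by simp
    also have "\<dots> \<le> vcount (head G a) (r - path_length len p)"
      using p(2) a(1) by (intro vcount_mono) auto
    also have "\<dots> \<le> vcount z r" by (rule vcount_awalk[OF p(1)])
    finally show ?thesis using a(2) by (simp add: algebra_simps)
  next
    case False
    then have "crit = 0" using crit_nonneg by simp
    moreover have "1 \<le> vcount z r"
      using z r D max_len_pos by (simp add: vcount_rec sum_nonneg walk_count_nonneg)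
    ultimately show ?thesis by simp
  qed
  then show ?thesis using that by blast
qed

section \<open>Volume entropy\<close>

context
  fixes z :: 'v
  assumes z: "z \<in> verts G"
begin

abbreviation cover :: "('e awalk, 'e awalk \<times> 'e) pre_digraph" where
  "cover \<equiv> universal_cover G arev z"

interpretation cov: metric_graph cover "cover_arev G arev z" "cover_len len"
  by (rule metric_graph_universal_cover) unfold_locales

lemma verts_cover_iff: "p \<in> verts cover \<longleftrightarrow> no_backtracking arev p \<and> (\<exists>u. awalk z p u)"
  by (simp add: universal_cover_def)

lemma arcs_cover_iff:
  "(p, a) \<in> arcs cover \<longleftrightarrow> no_backtracking arev p \<and> a \<in> arcs G \<and> awalk z p (tail G a)"
  by (simp add: universal_cover_def)

lemma tail_cover [simp]: "tail cover (p, a) = p"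
  and head_cover [simp]: "head cover (p, a) = reduced_snoc arev p a"
  by (simp_all add: universal_cover_def)

lemma path_length_append [simp]: "path_length len (p @ q) = path_length len p + path_length len q"
  by (simp add: path_length_def)

lemma path_length_single [simp]: "path_length len [a] = len a"
  by (simp add: path_length_def)

lemma path_length_reduced_snoc:
  assumes "(p, a) \<in> arcs cover"
  shows "path_length len (reduced_snoc arev p a) \<le> path_length len p + len a"
    and "path_length len p - len a \<le> path_length len (reduced_snoc arev p a)"
proof -
  have a: "a \<in> arcs G" "awalk z p (tail G a)" using assms by (auto simp: arcs_cover_iff)
  have "path_length len (reduced_snoc arev p a) \<le> path_length len p + len a \<and>
    path_length len p - len a \<le> path_length len (reduced_snoc arev p a)"
  proof (cases p rule: rev_cases)
    case Nil
    then show ?thesis using len_pos[OF a(1)] by (simp add: reduced_snoc_def path_length_def)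
  next
    case (snoc q b)
    have "b \<in> arcs G" using a(2) by (auto simp: snoc awalk_simps)
    then show ?thesis
      using len_pos[OF a(1)] len_arev by (auto simp: snoc reduced_snoc_def path_length_def)
  qed
  then show "path_length len (reduced_snoc arev p a) \<le> path_length len p + len a"
    and "path_length len p - len a \<le> path_length len (reduced_snoc arev p a)" by auto
qed

lemma cover_awalk_cost_ge:
  assumes "cov.awalk p W q"
  shows "path_length len q \<le> path_length len p + cov.awalk_cost (cover_len len) W"
  using assms
proof (induction W arbitrary: p)
  case Nil
  then show ?case by (simp add: cov.awalk_Nil_iff)
next
  case (Cons e W)
  obtain p' a where e: "e = (p', a)" by force
  have *: "(p, a) \<in> arcs cover" "p' = p" "cov.awalk (reduced_snoc arev p a) W q"
    using Cons.prems by (auto simp: cov.awalk_Cons_iff e)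
  show ?case
    using Cons.IH[OF *(3)] path_length_reduced_snoc(1)[OF *(1)]
    by (simp add: e cover_len_def)
qed

lemma cover_awalk_to:
  assumes "p \<in> verts cover"
  shows "\<exists>W. cov.awalk [] W p \<and> cov.awalk_cost (cover_len len) W = path_length len p"
  using assms
proof (induction p rule: rev_induct)
  case Nil
  then show ?case by (intro exI[of _ "[]"]) (simp add: cov.awalk_Nil_iff path_length_def)
next
  case (snoc a p)
  have p: "no_backtracking arev p" "awalk z p (tail G a)" "a \<in> arcs G"
    and a: "p \<noteq> [] \<Longrightarrow> a \<noteq> arev (last p)"
    using snoc.prems by (auto simp: verts_cover_iff no_backtracking_def successively_append_iff awalk_simps)
  have arc: "(p, a) \<in> arcs cover" using p by (simp add: arcs_cover_iff)
  have hd: "reduced_snoc arev p a = p @ [a]" using a by (auto simp: reduced_snoc_def)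
  obtain W where W: "cov.awalk [] W p" "cov.awalk_cost (cover_len len) W = path_length len p"
    using snoc.IH p by (auto simp: verts_cover_iff)
  have "cov.awalk [] (W @ [(p, a)]) (p @ [a])"
    using W(1) arc snoc.prems by (auto simp: cov.awalk_simps hd)
  moreover have "cov.awalk_cost (cover_len len) (W @ [(p, a)]) = path_length len (p @ [a])"
    using W(2) by (simp add: cover_len_def)
  ultimately show ?case by blast
qed

text \<open>The prefixes of \<open>p\<close> form a walk of this cost. Conversely, an arc of the
  cover changes \<open>path_length\<close> by at most its own length, and \<open>path_length\<close>
  vanishes at the base point.\<close>

lemma cover_dist:
  assumes "p \<in> verts cover"
  shows "cov.\<mu> (cover_len len) [] p = ereal (path_length len p)"
proof (rule antisym)
  show "cov.\<mu> (cover_len len) [] p \<le> ereal (path_length len p)"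
    using cover_awalk_to[OF assms] cov.min_cost_le_walk_cost by metis
  show "ereal (path_length len p) \<le> cov.\<mu> (cover_len len) [] p"
    unfolding cov.\<mu>_def
  proof (intro INF_greatest)
    fix W assume "W \<in> {W. cov.awalk [] W p}"
    then show "ereal (path_length len p) \<le> ereal (cov.awalk_cost (cover_len len) W)"
      using cover_awalk_cost_ge[of "[]" W p] by (simp add: path_length_def)
  qed
qed

abbreviation arc_volume :: "real \<Rightarrow> 'e awalk \<times> 'e \<Rightarrow> real" where
  "arc_volume r e \<equiv>
     measure lborel {t \<in> {0..cover_len len e}. dist_on_arc cover (cover_len len) [] e t \<le> ereal r}"

lemma arc_volume_bounds:
  assumes "(p, a) \<in> arcs cover"
  shows "arc_volume r (p, a) \<le> len a"
    and "r + len a < path_length len p \<Longrightarrow> arc_volume r (p, a) = 0"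
    and "path_length len p + len a \<le> r \<Longrightarrow> arc_volume r (p, a) = len a"
proof -
  have a: "a \<in> arcs G" "0 < len a" using assms len_pos by (auto simp: arcs_cover_iff)
  have V: "p \<in> verts cover" "reduced_snoc arev p a \<in> verts cover"
    using cov.tail_in_verts[OF assms] cov.head_in_verts[OF assms] by simp_all
  let ?A = "{t \<in> {0..cover_len len (p, a)}. dist_on_arc cover (cover_len len) [] (p, a) t \<le> ereal r}"
  have dist: "dist_on_arc cover (cover_len len) [] (p, a) t = ereal (min (path_length len p + t)
      (path_length len (reduced_snoc arev p a) + (len a - t)))" for t
    unfolding dist_on_arc_def tail_cover head_cover cover_dist[OF V(1)] cover_dist[OF V(2)]
    by (simp add: cover_len_def)
  have cl: "cover_len len (p, a) = len a" by (simp add: cover_len_def)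
  have sub: "?A \<subseteq> {0..len a}" by (auto simp: cl)
  show "arc_volume r (p, a) \<le> len a"
  proof (cases "?A \<in> sets lborel")
    case True
    have "{0..len a} \<in> fmeasurable lborel"
      by (rule fmeasurableI) (auto simp: emeasure_lborel_Icc_eq)
    then have "arc_volume r (p, a) \<le> measure lborel {0..len a}"
      by (rule measure_mono_fmeasurable[OF sub True])
    then show ?thesis using a by simp
  next
    \<comment> \<open>A set outside the sigma-algebra has measure 0 by default, which satisfies the
      bound as well.\<close>
    case False
    then show ?thesis using a by (simp add: measure_notin_sets)
  qed
  {
    assume r: "r + len a < path_length len p"
    have "?A = {}"
      using r path_length_reduced_snoc(2)[OF assms] a
      by (auto simp: dist cl min_def split: if_splits)
    then show "arc_volume r (p, a) = 0" by (simp only: measure_empty)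
  }
  {
    assume r: "path_length len p + len a \<le> r"
    have "?A = {0..len a}"
      using r a by (auto simp: dist cl min_def)
    then show "arc_volume r (p, a) = len a" using a by (simp only:) simp
  }
qed

text \<open>An arc whose tail is farther than \<open>r + max_len\<close> from the base point misses
  the ball, so the infinite sum is in fact finite.\<close>

lemma ball_volume_sum:
  shows "ball_volume cover (cover_len len) [] r
    = (\<Sum>e\<in>{e \<in> arcs cover. fst e \<in> vwalks z (r + max_len)}. arc_volume r e) / 2"
    and "finite {e \<in> arcs cover. fst e \<in> vwalks z (r + max_len)}"
proof -
  let ?X = "{e \<in> arcs cover. fst e \<in> vwalks z (r + max_len)}"
  have "?X \<subseteq> vwalks z (r + max_len) \<times> arcs G"
    by (auto simp: arcs_cover_iff)
  then show fin: "finite ?X"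
    by (rule finite_subset) (simp add: finite_vwalks z)
  have "(\<Sum>\<^sub>\<infinity>e\<in>arcs cover. arc_volume r e) = (\<Sum>\<^sub>\<infinity>e\<in>?X. arc_volume r e)"
  proof (rule infsum_cong_neutral)
    fix e assume e: "e \<in> arcs cover - ?X"
    obtain p a where pa: "e = (p, a)" by force
    have arc: "(p, a) \<in> arcs cover" "p \<notin> vwalks z (r + max_len)" using e by (auto simp: pa)
    then have "r + max_len < path_length len p"
      by (auto simp: vwalks_def arcs_cover_iff)
    then show "arc_volume r e = 0"
      unfolding pa using arc(1) max_len_ge[of a]
      by (intro arc_volume_bounds(2)) (auto simp: arcs_cover_iff)
  qed auto
  then show "ball_volume cover (cover_len len) [] r = (\<Sum>e\<in>?X. arc_volume r e) / 2"
    using fin by (simp add: ball_volume_def)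
qed

lemma ball_volume_le:
  "ball_volume cover (cover_len len) [] r \<le> card (arcs G) * max_len / 2 * vcount z (r + max_len)"
proof -
  let ?X = "{e \<in> arcs cover. fst e \<in> vwalks z (r + max_len)}"
  have "arc_volume r e \<le> max_len" if "e \<in> ?X" for e
  proof -
    obtain p a where pa: "e = (p, a)" by force
    have arc: "(p, a) \<in> arcs cover" using that by (simp add: pa)
    then have "a \<in> arcs G" by (simp add: arcs_cover_iff)
    then show ?thesis
      unfolding pa using arc_volume_bounds(1)[OF arc, of r] max_len_ge[of a] by linarith
  qed
  then have "(\<Sum>e\<in>?X. arc_volume r e) \<le> card ?X * max_len"
    by (rule sum_bounded_above)
  also have "\<dots> \<le> card (vwalks z (r + max_len) \<times> arcs G) * max_len"
    using max_len_pos
    by (intro mult_right_mono of_nat_mono card_mono) (auto simp: arcs_cover_iff finite_vwalks z)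
  finally show ?thesis
    unfolding ball_volume_sum by (simp add: card_cartesian_product vcount_def mult_ac)
qed

text \<open>Each cover vertex within \<open>r - max_len\<close> of the base point is the tail of an
  arc inside the ball, and arcs with different tails are different. The 2 is that of
  \<open>ball_volume\<close>.\<close>

lemma ball_volume_ge:
  assumes "\<And>v. v \<in> verts G \<Longrightarrow> out_arcs G v \<noteq> {}"
  shows "min_len / 2 * vcount z (r - max_len) \<le> ball_volume cover (cover_len len) [] r"
proof -
  let ?X = "{e \<in> arcs cover. fst e \<in> vwalks z (r + max_len)}"
  let ?Y = "vwalks z (r - max_len)"
  have "\<exists>a. (p, a) \<in> arcs cover" if "p \<in> ?Y" for p
  proof -
    obtain u where u: "awalk z p u" "no_backtracking arev p" using \<open>p \<in> ?Y\<close> by (auto simp: vwalks_def)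
    have "u \<in> verts G" using u by blast
    then obtain a where "a \<in> arcs G" "tail G a = u" using assms by fastforce
    then show ?thesis using u by (auto simp: arcs_cover_iff)
  qed
  then obtain \<alpha> where \<alpha>: "\<And>p. p \<in> ?Y \<Longrightarrow> (p, \<alpha> p) \<in> arcs cover" by metis
  have "min_len * card ?Y = (\<Sum>p\<in>?Y. min_len)" by simp
  also have "\<dots> \<le> (\<Sum>p\<in>?Y. arc_volume r (p, \<alpha> p))"
  proof (rule sum_mono)
    fix p assume p: "p \<in> ?Y"
    have a: "\<alpha> p \<in> arcs G" using \<alpha>[OF p] by (simp add: arcs_cover_iff)
    have "path_length len p + len (\<alpha> p) \<le> r"
      using p max_len_ge[OF a] by (simp add: vwalks_def)
    then have "arc_volume r (p, \<alpha> p) = len (\<alpha> p)" by (rule arc_volume_bounds(3)[OF \<alpha>[OF p]])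
    then show "min_len \<le> arc_volume r (p, \<alpha> p)" using min_len_le[OF a] by simp
  qed
  also have "\<dots> = (\<Sum>e\<in>(\<lambda>p. (p, \<alpha> p)) ` ?Y. arc_volume r e)"
    by (subst sum.reindex) (auto simp: inj_on_def)
  also have "\<dots> \<le> (\<Sum>e\<in>?X. arc_volume r e)"
    using \<alpha> max_len_pos by (intro sum_mono2 ball_volume_sum(2)) (auto simp: vwalks_def)
  finally show ?thesis unfolding ball_volume_sum(1) vcount_def by simp
qed

end

lemma ball_volume_entropy:
  assumes "strongly_connected G" "arcs G \<noteq> {}" "z \<in> verts G"
  shows "((\<lambda>r. ln (ball_volume (universal_cover G arev z) (cover_len len) [] r) / r) \<longlongrightarrow> crit) at_top"
proof -
  let ?V = "\<lambda>r. ball_volume (universal_cover G arev z) (cover_len len) [] r"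
  have out: "out_arcs G v \<noteq> {}" if v: "v \<in> verts G" for v
  proof -
    obtain a where a: "a \<in> arcs G" using assms(2) by blast
    show ?thesis
    proof (cases "tail G a = v")
      case True
      then show ?thesis using a by auto
    next
      case False
      have "v \<rightarrow>\<^sup>*\<^bsub>G\<^esub> tail G a" using assms(1) v a by (auto elim: strongly_connectedE)
      then obtain p where p: "awalk v p (tail G a)" by (auto simp: reachable_awalk)
      then have "p \<noteq> []" using False by (auto simp: awalk_Nil_iff)
      then obtain b q where "p = b # q" by (cases p) auto
      then show ?thesis using p by (auto simp: awalk_Cons_iff)
    qed
  qed
  obtain D where D: "\<And>z r. z \<in> verts G \<Longrightarrow> D \<le> r \<Longrightarrow> exp (crit * (r - D)) \<le> vcount z r"
    using vcount_ge[OF assms(1)] by blast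
  show ?thesis
  proof (rule growth_rate_tendsto)
    show "0 < min_len / 2 * exp (- crit * (D + max_len))" using min_len_pos by simp
    fix r assume "D + max_len \<le> r"
    then have "exp (crit * (r - max_len - D)) \<le> vcount z (r - max_len)"
      using D[OF assms(3), of "r - max_len"] by simp
    then have "min_len / 2 * exp (crit * (r - max_len - D)) \<le> min_len / 2 * vcount z (r - max_len)"
      using min_len_pos by (intro mult_left_mono) auto
    also have "\<dots> \<le> ?V r" by (rule ball_volume_ge[OF assms(3) out])
    finally show "min_len / 2 * exp (- crit * (D + max_len)) * exp (crit * r) \<le> ?V r"
      by (simp add: mult.assoc exp_add[symmetric] algebra_simps)
  next
    fix s assume s: "crit < s"
    have conv: "convergent_at s" "0 \<le> s" using convergent_above_crit[OF s] crit_nonneg s by auto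
    define K where "K = card (arcs G) * max_len / 2 * (vgreen s (\<lambda>_. 1) z * exp (s * max_len))"
    have c: "0 < card (arcs G) * max_len / 2"
      using assms(2) max_len_pos by (simp add: card_gt_0_iff)
    have "1 \<le> vgreen s (\<lambda>_. 1) z" using vgreen_nonneg[OF conv(1) _ assms(3), of "\<lambda>_. 1"] by simp
    then have "0 < K" unfolding K_def using c by (intro mult_pos_pos) auto
    moreover have "?V r \<le> K * exp (s * r)" for r
    proof -
      have "?V r \<le> card (arcs G) * max_len / 2 * vcount z (r + max_len)"
        by (rule ball_volume_le[OF assms(3)])
      also have "\<dots> \<le> card (arcs G) * max_len / 2 * (vgreen s (\<lambda>_. 1) z * exp (s * (r + max_len)))"
        using c by (intro mult_left_mono vcount_le assms(3) conv) auto
      finally show ?thesis by (simp add: K_def distrib_left exp_add mult_ac)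
    qed
    ultimately show "\<exists>K>0. \<forall>r\<ge>0. ?V r \<le> K * exp (s * r)" by blast
  qed
qed

lemma volume_entropy_eq_crit:
  assumes "strongly_connected G" "arcs G \<noteq> {}"
  shows "volume_entropy G arev len = crit"
proof -
  have "(\<lambda>z. Lim at_top (\<lambda>r. ln (ball_volume (universal_cover G arev z) (cover_len len) [] r) / r))
      ` verts G = {crit}"
  proof -
    have "Lim at_top (\<lambda>r. ln (ball_volume (universal_cover G arev z) (cover_len len) [] r) / r) = crit"
      if "z \<in> verts G" for z
      using ball_volume_entropy[OF assms that] by (intro tendsto_Lim) auto
    moreover have "verts G \<noteq> {}" using assms(1) by (simp add: strongly_connected_def)
    ultimately show ?thesis by auto
  qed
  then show ?thesis by (simp add: volume_entropy_def)
qed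

section \<open>The Green function near the critical exponent\<close>

lemma green_le_vgreen:
  assumes "convergent_at s" "\<And>z. z \<in> verts G \<Longrightarrow> 0 \<le> \<phi> z" "a \<in> arcs G"
  shows "green s \<phi> a \<le> vgreen s \<phi> (head G a)"
  using vgreen_head[OF assms] green_nonneg[OF assms(1,2), where a = "arev a"] assms(3) by simp

text \<open>
  For \<open>crit < s' < s\<close>, the function \<open>w\<close>, the normalised Green function at \<open>s'\<close>, is contracted by the
  transfer operator at \<open>s\<close> by the factor \<open>1 - \<kappa>\<close>. It is bounded from below on the arcs that are
  not thin, and \<open>D'\<close> corrects it on the thin ones.
\<close>

lemma green_pole_upper:
  assumes "strongly_connected G" "0 < crit"
  obtains C where "0 \<le> C"
    "\<And>s a. crit < s \<Longrightarrow> s \<le> crit + 1 \<Longrightarrow> a \<in> arcs G \<Longrightarrow> green s (\<lambda>_. 1) a \<le> C / (s - crit)"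
proof -
  let ?g = "\<lambda>s. green s (\<lambda>_. 1)"
  obtain v0 where v0: "v0 \<in> verts G" using assms(1) by (auto simp: strongly_connected_def)
  \<comment> \<open>By the Harnack inequality all vertex sums at \<open>s\<close> are comparable to
    this one, which serves as the scale of the Green function.\<close>
  define p where "p = (\<lambda>s. vgreen s (\<lambda>_. 1) v0)"
  have conv: "convergent_at s" "0 \<le> s" if "crit < s" for s
    using convergent_above_crit[OF that] that assms(2) by auto
  have p1: "1 \<le> p s" if "crit < s" for s
    unfolding p_def using vgreen_nonneg[OF conv(1)[OF that] _ v0, of "\<lambda>_. 1"] by simp
  have g0: "0 \<le> ?g s a" if "crit < s" "a \<in> arcs G" for s a
    using conv that by (intro green_nonneg) auto
  obtain D where D: "0 \<le> D"
    "\<And>u v s \<phi>. u \<in> verts G \<Longrightarrow> v \<in> verts G \<Longrightarrow> convergent_at s \<Longrightarrow> 0 \<le> s \<Longrightarrow>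
       (\<And>z. z \<in> verts G \<Longrightarrow> 0 \<le> \<phi> z) \<Longrightarrow> exp (- s * D) * vgreen s \<phi> u \<le> vgreen s \<phi> v"
    using vgreen_compare[OF assms(1)] by blast
  define U where "U = exp ((crit + 1) * D)"
  have U: "?g s a \<le> U * p s" if s: "crit < s" "s \<le> crit + 1" and a: "a \<in> arcs G" for s a
  proof -
    have "exp (- s * D) * ?g s a \<le> exp (- s * D) * vgreen s (\<lambda>_. 1) (head G a)"
      using green_le_vgreen[OF conv(1)[OF s(1)] _ a, of "\<lambda>_. 1"] by simp
    also have "\<dots> \<le> p s" unfolding p_def using D(2)[of "head G a" v0 s "\<lambda>_. 1"] a v0 conv[OF s(1)] by simp
    finally have "exp (s * D) * (exp (- s * D) * ?g s a) \<le> exp (s * D) * p s"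
      by (rule mult_left_mono) simp
    then have "?g s a \<le> exp (s * D) * p s"
      by (simp only: mult.assoc[symmetric] exp_add[symmetric]) simp
    also have "\<dots> \<le> U * p s"
      unfolding U_def using s D(1) p1[OF s(1)] by (intro mult_right_mono) (auto intro: mult_right_mono)
    finally show ?thesis .
  qed
  have "\<forall>a. \<exists>d\<ge>0. a \<in> arcs G \<longrightarrow> \<not> thin a \<longrightarrow> (\<forall>s v. convergent_at s \<longrightarrow> 0 \<le> s \<longrightarrow> v \<in> verts G \<longrightarrow>
    exp (- s * d) / 2 * vgreen s (\<lambda>_. 1) v \<le> ?g s a)"
    using green_not_thin[OF assms(1)] by (metis order_refl)
  then obtain d where d: "\<And>a. 0 \<le> d a" "\<And>a s v. a \<in> arcs G \<Longrightarrow> \<not> thin a \<Longrightarrow> convergent_at s \<Longrightarrow> 0 \<le> s \<Longrightarrow>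
    v \<in> verts G \<Longrightarrow> exp (- s * d a) / 2 * vgreen s (\<lambda>_. 1) v \<le> ?g s a"
    by metis
  define c where "c = exp (- (crit + 1) * (\<Sum>a\<in>arcs G. d a)) / 2"
  have c0: "0 < c" by (simp add: c_def)
  have c: "c * p s \<le> ?g s a" if s: "crit < s" "s \<le> crit + 1" and a: "a \<in> arcs G" "\<not> thin a" for s a
  proof -
    have "d a \<le> (\<Sum>a\<in>arcs G. d a)" using a d(1) by (intro member_le_sum) auto
    then have "s * d a \<le> (crit + 1) * (\<Sum>a\<in>arcs G. d a)"
      using s conv[OF s(1)] d(1) by (intro mult_mono) auto
    then have "c * p s \<le> exp (- s * d a) / 2 * p s"
      unfolding c_def using p1[OF s(1)] by (intro mult_right_mono divide_right_mono) (simp_all add: algebra_simps)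
    also have "\<dots> \<le> ?g s a" unfolding p_def using d(2)[OF a conv[OF s(1)] v0] .
    finally show ?thesis .
  qed
  define K where "K = card (arcs G) / (1 - exp (- crit * min_len))"
  have K0: "0 \<le> K" unfolding K_def using assms(2) min_len_pos by simp
  have K: "?g s a \<le> K" if s: "crit < s" and a: "a \<in> arcs G" "thin a" for s a
  proof -
    have "?g s a \<le> card (arcs G) / (1 - exp (- s * min_len))"
      using green_thin[OF a(2,1)] s assms(2) by simp
    also have "\<dots> \<le> K"
      unfolding K_def using s assms(2) min_len_pos by (intro divide_left_mono) auto
    finally show ?thesis .
  qed
  \<comment> \<open>The source 1 together with the contribution of the thin successors through
    \<open>D'\<close>, at most \<open>K\<close> each.\<close>
  define N where "N = 1 + card (arcs G) * K"
  have N: "1 \<le> N" using K0 by (simp add: N_def)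
  \<comment> \<open>Chosen such that \<open>N * U / (\<kappa> * c) \<le> Q / (s - s')\<close>, by
    the lower bound \<open>(s - s') * min_len / (1 + min_len)\<close> for \<kappa>.\<close>
  define Q where "Q = N * U * (1 + min_len) / (c * min_len)"
  have Q0: "0 \<le> Q" unfolding Q_def using N c0 min_len_pos by (simp add: U_def)
  have main: "?g s a \<le> Q / (s - s') + K"
    if s: "crit < s'" "s' < s" "s \<le> crit + 1" and a: "a \<in> arcs G" for s s' a
  proof -
    have s1: "crit < s" "s' \<le> crit + 1" using s by auto
    \<comment> \<open>The size of \<open>p s'\<close> is unknown and drops out: after normalisation
      only \<open>U\<close> and \<open>c\<close> matter, and they are the same for all
      \<open>s'\<close>.\<close>
    define w where "w = (\<lambda>a. ?g s' a / p s')"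
    define \<kappa> where "\<kappa> = 1 - exp (- (s - s') * min_len)"
    have \<kappa>: "0 < \<kappa>" "(s - s') * min_len / (1 + min_len) \<le> \<kappa>"
    proof -
      define x where "x = (s - s') * min_len"
      have x: "0 < x" "x \<le> min_len" using s min_len_pos assms(2) by (auto simp: x_def mult_left_le_one_le)
      have \<kappa>x: "\<kappa> = 1 - exp (- x)" by (simp add: \<kappa>_def x_def algebra_simps)
      show "0 < \<kappa>" using x by (simp add: \<kappa>x)
      have "exp (- x) \<le> 1 / (1 + x)"
        using exp_ge_add_one_self[of x] x by (simp add: exp_minus field_simps)
      also have "\<dots> = 1 - x / (1 + x)" using x by (simp add: field_simps)
      also have "\<dots> \<le> 1 - x / (1 + min_len)" using x by (simp add: divide_left_mono)
      finally show "(s - s') * min_len / (1 + min_len) \<le> \<kappa>" by (simp add: \<kappa>x, simp add: x_def)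
    qed
    have p': "0 < p s'" using p1[OF s(1)] by simp
    have w0: "0 \<le> w b" if "b \<in> arcs G" for b using g0[OF s(1) that] p' by (simp add: w_def)
    have wU: "w b \<le> U" if "b \<in> arcs G" for b using U[OF s(1) s1(2) that] p' by (simp add: w_def divide_le_eq)
    have wc: "c \<le> w b" if "b \<in> arcs G" "\<not> thin b" for b
      using c[OF s(1) s1(2) that] p' by (simp add: w_def le_divide_eq)
    have wT: "transfer s w b \<le> (1 - \<kappa>) * w b" if b: "b \<in> arcs G" for b
    proof -
      have "transfer s w b \<le> exp (- (s - s') * min_len) * transfer s' w b"
        unfolding transfer_def sum_distrib_left
      proof (intro sum_mono)
        fix e assume "e \<in> succs b"
        then have e: "e \<in> arcs G" by (rule succs_arcs)
        have "(s - s') * min_len \<le> (s - s') * len e"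
          using min_len_le[OF e] s by (intro mult_left_mono) auto
        then have "wt s e \<le> exp (- (s - s') * min_len) * wt s' e"
          by (simp add: wt_def exp_add[symmetric] algebra_simps)
        then show "wt s e * w e \<le> exp (- (s - s') * min_len) * (wt s' e * w e)"
          using w0[OF e] by (simp only: mult.assoc[symmetric] mult_right_mono)
      qed
      also have "transfer s' w b \<le> w b"
      proof -
        have "transfer s' w b = transfer s' (?g s') b / p s'"
          by (simp add: w_def transfer_def sum_divide_distrib)
        also have "\<dots> \<le> w b"
          using green_eq[OF conv(1)[OF s(1)], of "\<lambda>_. 1" b] b p' by (simp add: w_def divide_right_mono)
        finally show ?thesis .
      qed
      finally show ?thesis by (simp add: \<kappa>_def)
    qed
    \<comment> \<open>Successors of thin arcs are thin, so on thin arcs this part solves the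
      equation of the Green function exactly, and \<open>w\<close> has to satisfy only
      \<open>transfer s w b \<le> w b\<close> there.\<close>
    define D' where "D' = (\<lambda>b. if thin b then ?g s b else 0)"
    define W where "W = (\<lambda>b. N / (\<kappa> * c) * w b + D' b)"
    have k0: "0 < N / (\<kappa> * c)" using N \<kappa> c0 by simp
    have "?g s a \<le> W a"
    proof (rule green_le)
      fix b assume b: "b \<in> arcs G"
      have "0 \<le> N / (\<kappa> * c) * w b" by (rule mult_nonneg_nonneg[OF less_imp_le[OF k0] w0[OF b]])
      then show "0 \<le> W b" using g0[OF s1(1) b] unfolding W_def D'_def by simp
      have TW: "transfer s W b = N / (\<kappa> * c) * transfer s w b + transfer s D' b"
        unfolding W_def by (simp only: transfer_add transfer_cmult)
      show "1 + transfer s W b \<le> W b"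
      proof (cases "thin b")
        case True
        have "transfer s D' b = transfer s (?g s) b"
          unfolding transfer_def D'_def using thin_succs[OF True] by (intro sum.cong) auto
        moreover have "transfer s w b \<le> w b"
          using wT[OF b] mult_nonneg_nonneg[OF less_imp_le[OF \<kappa>(1)] w0[OF b]] by (simp add: algebra_simps)
        then have "N / (\<kappa> * c) * transfer s w b \<le> N / (\<kappa> * c) * w b"
          using k0 by (intro mult_left_mono) auto
        ultimately show ?thesis
          unfolding TW using green_eq[OF conv(1)[OF s1(1)], of "\<lambda>_. 1" b] b True by (simp add: W_def D'_def)
      next
        case False
        have "transfer s D' b \<le> (\<Sum>e\<in>succs b. K)"
          unfolding transfer_def
        proof (intro sum_mono)
          fix e assume "e \<in> succs b"
          then have e: "e \<in> arcs G" by (rule succs_arcs)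
          have "D' e \<le> K" "0 \<le> D' e" using K[OF s1(1) e] K0 g0[OF s1(1) e] by (auto simp: D'_def)
          then have "wt s e * D' e \<le> 1 * K"
            using wt_le_1[OF conv(2)[OF s1(1)] e] by (intro mult_mono) auto
          then show "wt s e * D' e \<le> K" by simp
        qed
        also have "\<dots> \<le> card (arcs G) * K"
          using K0 succs_subset[of b] by (simp add: mult_right_mono card_mono)
        finally have 1: "transfer s D' b \<le> N - 1" by (simp add: N_def)
        \<comment> \<open>Off the thin arcs the contraction gains \<open>N / c * w b\<close>, which
          is at least \<open>N\<close>.\<close>
        have "N / (\<kappa> * c) * transfer s w b \<le> N / (\<kappa> * c) * ((1 - \<kappa>) * w b)"
          using wT[OF b] k0 by (intro mult_left_mono) auto
        also have "\<dots> = N / (\<kappa> * c) * w b - N / c * w b"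
          using \<kappa>(1) c0 by (simp add: field_simps)
        also have "\<dots> \<le> N / (\<kappa> * c) * w b - N"
        proof -
          have "N / c * c \<le> N / c * w b" using wc[OF b False] N c0 by (intro mult_left_mono) auto
          then show ?thesis using c0 by simp
        qed
        finally show ?thesis unfolding TW using 1 False by (simp add: W_def D'_def)
      qed
    qed (use a in auto)
    also have "\<dots> \<le> N / (\<kappa> * c) * U + K"
      unfolding W_def using wU[OF a] k0 K[OF s1(1) a] K0
      by (intro add_mono mult_left_mono) (auto simp: D'_def)
    also have "N / (\<kappa> * c) * U \<le> Q / (s - s')"
    proof -
      have "N * U / c / \<kappa> \<le> N * U / c / ((s - s') * min_len / (1 + min_len))"
        using \<kappa> N c0 s min_len_pos by (intro divide_left_mono mult_pos_pos) (auto simp: U_def)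
      also have "\<dots> = Q / (s - s')" unfolding Q_def using c0 min_len_pos by simp
      finally show ?thesis by (simp add: mult_ac)
    qed
    finally show ?thesis by simp
  qed
  have "?g s a \<le> (2 * Q + K) / (s - crit)" if s: "crit < s" "s \<le> crit + 1" and a: "a \<in> arcs G" for s a
  proof -
    \<comment> \<open>The midpoint as \<open>s'\<close> keeps \<open>s - s'\<close> of the order of
      \<open>s - crit\<close>.\<close>
    have "?g s a \<le> Q / (s - (crit + s) / 2) + K" using s by (intro main a) auto
    also have "s - (crit + s) / 2 = (s - crit) / 2" by (simp add: field_simps)
    also have "Q / ((s - crit) / 2) + K \<le> (2 * Q + K) / (s - crit)"
    proof -
      have "K * (s - crit) \<le> K * 1" using K0 s by (intro mult_left_mono) auto
      then have "K \<le> K / (s - crit)" using s by (simp add: le_divide_eq)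
      then show ?thesis by (simp add: add_divide_distrib mult.commute)
    qed
    finally show ?thesis .
  qed
  then show ?thesis using that[of "2 * Q + K"] Q0 K0 by auto
qed

lemma eventually_at_right_crit: "0 < \<epsilon> \<Longrightarrow> \<forall>\<^sub>F s in at_right crit. crit < s \<and> s < crit + \<epsilon>"
  unfolding eventually_at_right_field by (intro exI[of _ "crit + \<epsilon>"]) auto

lemma green_mero_germ_pos:
  assumes "\<And>z. 0 < \<phi> z" "a \<in> arcs G"
  shows "mero_germ crit (\<lambda>s. green s \<phi> a)"
proof (rule mero_germ_linear_system[where S = "arcs G" and b = "\<lambda>a s. \<phi> (head G a)"
      and B = "\<lambda>a b s. if b \<in> succs a then wt s b else 0"])
  have nn: "0 \<le> \<phi> z" for z using assms(1) less_imp_le by blast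
  show "mero_germ crit (\<lambda>s. if c \<in> succs b then wt s c else 0)" for b c
    unfolding wt_def by (cases "c \<in> succs b") (simp_all only: if_True if_False mero_germ_exp mero_germ_const)
  have conv: "\<forall>\<^sub>F s in at_right crit. convergent_at s"
    using eventually_at_right_less by eventually_elim (rule convergent_above_crit)
  then show "\<forall>\<^sub>F s in at_right crit. \<forall>a\<in>arcs G. green s \<phi> a = \<phi> (head G a)
      + (\<Sum>c\<in>arcs G. (if c \<in> succs a then wt s c else 0) * green s \<phi> c)"
  proof eventually_elim
    case (elim s)
    show ?case
    proof
      fix a assume "a \<in> arcs G"
      then show "green s \<phi> a = \<phi> (head G a)
          + (\<Sum>c\<in>arcs G. (if c \<in> succs a then wt s c else 0) * green s \<phi> c)"
        using green_eq[OF elim nn] by (simp add: transfer_arcs if_distrib if_distribR cong: if_cong)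
    qed
  qed
  show "\<forall>\<^sub>F s in at_right crit. \<forall>a\<in>arcs G. 0 < \<phi> (head G a) \<and> 0 < green s \<phi> a
      \<and> (\<forall>c\<in>arcs G. 0 \<le> (if c \<in> succs a then wt s c else 0))"
    using conv
  proof eventually_elim
    case (elim s)
    show ?case
    proof (intro ballI conjI)
      fix a assume a: "a \<in> arcs G"
      have "0 \<le> transfer s (green s \<phi>) a"
        using green_nonneg[OF elim nn] by (rule transfer_nonneg)
      then show "0 < green s \<phi> a"
        using green_eq[OF elim nn a] assms(1)[of "head G a"] by simp
    qed (use assms(1) in auto)
  qed
qed (use assms(2) in auto)

text \<open>The elimination needs a positive source, so the indicator is written as
  \<open>1 + ind v\<close> minus 1.\<close>

lemma vgreen_ind_mero_germ: "mero_germ crit (\<lambda>s. vgreen s (ind v) u)"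
proof -
  have "mero_germ crit (\<lambda>s. green s (ind v) a)" if a: "a \<in> arcs G" for a
  proof -
    have "mero_germ crit (\<lambda>s. green s (\<lambda>z. 1 + ind v z) a - green s (\<lambda>_. 1) a)"
      using a by (intro mero_germ_diff green_mero_germ_pos) (auto simp: add_pos_nonneg)
    then show ?thesis
    proof (rule mero_germ_cong)
      show "\<forall>\<^sub>F s in at_right crit. green s (\<lambda>z. 1 + ind v z) a - green s (\<lambda>_. 1) a = green s (ind v) a"
        using eventually_at_right_less
      proof eventually_elim
        case (elim s)
        then show ?case using green_add[OF convergent_above_crit, of s "\<lambda>_. 1" "ind v" a] a by simp
      qed
    qed
  qed
  then show ?thesis
    unfolding vgreen_def wt_def
    by (intro mero_germ_add mero_germ_sum mero_germ_mult mero_germ_exp mero_germ_const) auto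
qed

text \<open>\<open>green_pole_upper\<close> bounds the product with \<open>s - crit\<close>, so its
  germ extends to \<open>crit\<close>. \<open>green_pole_lower\<close>, carried to \<open>u\<close>
  and \<open>v\<close> by comparing starts and ends of walks, keeps the limit \<open>A\<close> away
  from 0.\<close>

lemma vgreen_ind_asymp:
  assumes "strongly_connected G" "0 < crit" "u \<in> verts G" "v \<in> verts G"
  obtains A M where "0 < A" "0 < M"
    "\<forall>\<^sub>F s in at_right crit. \<bar>(s - crit) * vgreen s (ind v) u - A\<bar> \<le> M * (s - crit)"
proof -
  obtain C where C: "0 \<le> C"
    "\<And>s a. crit < s \<Longrightarrow> s \<le> crit + 1 \<Longrightarrow> a \<in> arcs G \<Longrightarrow> green s (\<lambda>_. 1) a \<le> C / (s - crit)"
    using green_pole_upper[OF assms(1,2)] by metis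
  have ind_le: "0 \<le> ind v z" "ind v z \<le> 1" for z by (auto simp: indicator_def)
  have upper: "\<forall>\<^sub>F s in at_right crit. \<bar>(s - crit) * vgreen s (ind v) u\<bar> \<le> 1 + card (arcs G) * C"
    using eventually_at_right_crit[OF zero_less_one]
  proof eventually_elim
    case (elim s)
    have conv: "convergent_at s" "0 \<le> s" using convergent_above_crit elim assms(2) by auto
    have "(\<Sum>a\<in>out_arcs G u. wt s a * green s (ind v) a) \<le> (\<Sum>a\<in>arcs G. C / (s - crit))"
    proof -
      have "(\<Sum>a\<in>out_arcs G u. wt s a * green s (ind v) a) \<le> (\<Sum>a\<in>out_arcs G u. C / (s - crit))"
      proof (intro sum_mono)
        fix a assume "a \<in> out_arcs G u"
        then have a: "a \<in> arcs G" by simp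
        have "wt s a * green s (ind v) a \<le> 1 * green s (\<lambda>_. 1) a"
          using wt_le_1[OF conv(2) a] conv a ind_le
          by (intro mult_mono green_mono green_nonneg) auto
        then show "wt s a * green s (ind v) a \<le> C / (s - crit)" using C(2)[OF _ _ a] elim by fastforce
      qed
      also have "\<dots> \<le> (\<Sum>a\<in>arcs G. C / (s - crit))"
        using C(1) elim by (intro sum_mono2) auto
      finally show ?thesis .
    qed
    then have "vgreen s (ind v) u \<le> 1 + card (arcs G) * (C / (s - crit))"
      unfolding vgreen_def using ind_le(2)[of u] by (simp only: sum_constant add_mono)
    then have "(s - crit) * vgreen s (ind v) u \<le> (s - crit) * (1 + card (arcs G) * (C / (s - crit)))"
      using elim by (intro mult_left_mono) auto
    also have "\<dots> = (s - crit) + card (arcs G) * C" using elim by (simp add: field_simps)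
    also have "\<dots> \<le> 1 + card (arcs G) * C" using elim by simp
    finally have "(s - crit) * vgreen s (ind v) u \<le> 1 + card (arcs G) * C" .
    moreover have "0 \<le> vgreen s (ind v) u"
      using vgreen_nonneg[OF conv(1) _ assms(3), of "ind v"] ind_le(1) order_trans by blast
    ultimately show ?case using elim by (simp add: abs_mult)
  qed
  have "mero_germ crit (\<lambda>s. (s - crit) * vgreen s (ind v) u)"
    by (intro mero_germ_mult mero_germ_diff vgreen_ind_mero_germ mero_germ_ident mero_germ_const)
  then obtain A M where M: "0 < M"
    "\<forall>\<^sub>F s in at_right crit. \<bar>(s - crit) * vgreen s (ind v) u - A\<bar> \<le> M * (s - crit)"
    using mero_germ_bounded[OF _ upper] by blast
  obtain c \<epsilon> where c: "0 < c" "0 < \<epsilon>"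
    "\<And>s. crit < s \<Longrightarrow> s < crit + \<epsilon> \<Longrightarrow> \<exists>a\<in>arcs G. c / (s - crit) \<le> green s (\<lambda>_. 1) a"
    using green_pole_lower[OF assms(2)] by metis
  obtain D where D: "0 \<le> D"
    "\<And>u v s \<phi>. u \<in> verts G \<Longrightarrow> v \<in> verts G \<Longrightarrow> convergent_at s \<Longrightarrow> 0 \<le> s \<Longrightarrow>
       (\<And>z. z \<in> verts G \<Longrightarrow> 0 \<le> \<phi> z) \<Longrightarrow> exp (- s * D) * vgreen s \<phi> u \<le> vgreen s \<phi> v"
    using vgreen_compare[OF assms(1)] by blast
  obtain D' where D': "0 \<le> D'"
    "\<And>u v s. u \<in> verts G \<Longrightarrow> v \<in> verts G \<Longrightarrow> convergent_at s \<Longrightarrow> 0 \<le> s \<Longrightarrow>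
       exp (- s * D') * vgreen s (\<lambda>_. 1) u \<le> card (verts G) * vgreen s (ind v) u"
    using vgreen_ind_ge[OF assms(1)] by blast
  \<comment> \<open>\<open>D\<close> moves the start of the walks to \<open>u\<close>;
    \<open>D'\<close> and the number of vertices come from fixing their end at \<open>v\<close>;
    \<open>crit + 1\<close> bounds \<open>s\<close>.\<close>
  define L where "L = exp (- (crit + 1) * (D + D')) * c / card (verts G)"
  have V: "0 < real (card (verts G))" using assms(3) by (auto simp: card_gt_0_iff)
  then have "0 < L" using c by (simp add: L_def)
  have lower: "\<forall>\<^sub>F s in at_right crit. L \<le> (s - crit) * vgreen s (ind v) u"
    using eventually_at_right_crit[OF c(2)] eventually_at_right_crit[OF zero_less_one]
  proof eventually_elim
    case (elim s)
    have conv: "convergent_at s" "0 \<le> s" using convergent_above_crit elim assms(2) by auto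
    obtain a where a: "a \<in> arcs G" "c / (s - crit) \<le> green s (\<lambda>_. 1) a" using c(3) elim by blast
    have ge: "c / (s - crit) \<le> vgreen s (\<lambda>_. 1) (head G a)"
      using a(2) green_le_vgreen[OF conv(1) _ a(1), of "\<lambda>_. 1"] by simp
    have "exp (- (crit + 1) * (D + D')) \<le> exp (- s * (D + D'))"
      using mult_right_mono[of s "crit + 1" "D + D'"] elim D(1) D'(1) by (simp add: algebra_simps)
    then have "exp (- (crit + 1) * (D + D')) * (c / (s - crit)) \<le> exp (- s * (D + D')) * vgreen s (\<lambda>_. 1) (head G a)"
      using ge c(1) elim by (intro mult_mono) auto
    also have "\<dots> = exp (- s * D') * (exp (- s * D) * vgreen s (\<lambda>_. 1) (head G a))"
      by (simp add: mult.assoc[symmetric] exp_add[symmetric] algebra_simps)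
    also have "\<dots> \<le> exp (- s * D') * vgreen s (\<lambda>_. 1) u"
      using D(2)[of "head G a" u s "\<lambda>_. 1"] a(1) assms(3) conv by (intro mult_left_mono) auto
    also have "\<dots> \<le> card (verts G) * vgreen s (ind v) u"
      by (rule D'(2)[OF assms(3,4) conv])
    finally have "exp (- (crit + 1) * (D + D')) * (c / (s - crit)) * ((s - crit) / card (verts G))
        \<le> card (verts G) * vgreen s (ind v) u * ((s - crit) / card (verts G))"
      using elim by (intro mult_right_mono) auto
    moreover have "exp (- (crit + 1) * (D + D')) * (c / (s - crit)) * ((s - crit) / card (verts G)) = L"
      using elim by (simp add: L_def)
    moreover have "card (verts G) * vgreen s (ind v) u * ((s - crit) / card (verts G))
        = (s - crit) * vgreen s (ind v) u"
      using assms(3) by auto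
    ultimately show ?case by (simp only:)
  qed
  have "L \<le> A"
  proof -
    have "((\<lambda>s. A + M * (s - crit)) \<longlongrightarrow> A + M * (crit - crit)) (at_right crit)"
      by (intro tendsto_intros)
    then have "((\<lambda>s. A + M * (s - crit)) \<longlongrightarrow> A) (at_right crit)" by simp
    moreover have "\<forall>\<^sub>F s in at_right crit. L \<le> A + M * (s - crit)"
      using lower M(2) by eventually_elim linarith
    ultimately show ?thesis by (rule tendsto_lowerbound) simp
  qed
  then show ?thesis using that[of A M] M \<open>0 < L\<close> by simp
qed

section \<open>The attached edge\<close>

text \<open>Subtracting 1 removes the empty walk: going back right after crossing the new edge would
  be backtracking, so a nonempty closed walk has to come in between.\<close>

definition loop_green :: "real \<Rightarrow> 'v \<Rightarrow> real" where
  "loop_green s v = vgreen s (ind v) v - 1"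

context
  fixes x y :: 'v and l :: real
  assumes x: "x \<in> verts G" and y: "y \<in> verts G" and xy: "x \<noteq> y" and l: "0 < l"
begin

interpretation att: finite_metric_graph "attach_edge G x y" "attach_arev arev" "attach_len len l"
  by (rule finite_metric_graph_attach_edge) (unfold_locales, use x y l in auto)

lemma attach_succs_Inl:
  assumes "a \<in> arcs G"
  shows "att.succs (Inl a) = Inl ` succs a \<union> (if head G a = x then {Inr True} else {})
    \<union> (if head G a = y then {Inr False} else {})"
proof (rule set_eqI)
  fix b
  show "b \<in> att.succs (Inl a) \<longleftrightarrow> b \<in> Inl ` succs a \<union> (if head G a = x then {Inr True} else {})
    \<union> (if head G a = y then {Inr False} else {})"
    unfolding att.succs_def succs_def
    using xy by (cases b) (auto simp: attach_edge_def attach_arev_def image_iff)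
qed

text \<open>As \<open>x \<noteq> y\<close>, the only new arc leaving \<open>y\<close> is
  \<open>Inr False\<close>, the reverse of \<open>Inr True\<close>, so only old arcs can follow;
  likewise at \<open>x\<close>.\<close>

lemma attach_succs_Inr:
  "att.succs (Inr True) = Inl ` out_arcs G y" "att.succs (Inr False) = Inl ` out_arcs G x"
proof -
  have "b \<in> att.succs (Inr True) \<longleftrightarrow> b \<in> Inl ` out_arcs G y"
    "b \<in> att.succs (Inr False) \<longleftrightarrow> b \<in> Inl ` out_arcs G x" for b
    unfolding att.succs_def
    using xy by (cases b; auto simp: attach_edge_def attach_arev_def image_iff)+
  then show "att.succs (Inr True) = Inl ` out_arcs G y" "att.succs (Inr False) = Inl ` out_arcs G x"
    by blast+
qed

lemma attach_wt [simp]: "att.wt s (Inl a) = wt s a" "att.wt s (Inr b) = exp (- s * l)"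
  unfolding att.wt_def wt_def by (simp_all add: attach_len_def)

lemma attach_transfer_Inl:
  assumes "a \<in> arcs G"
  shows "att.transfer s W (Inl a) = transfer s (\<lambda>a. W (Inl a)) a
    + exp (- s * l) * (ind x (head G a) * W (Inr True) + ind y (head G a) * W (Inr False))"
proof -
  have "(\<Sum>b\<in>Inl ` succs a. att.wt s b * W b) = transfer s (\<lambda>a. W (Inl a)) a"
    unfolding transfer_def by (subst sum.reindex) auto
  then show ?thesis
    unfolding att.transfer_def attach_succs_Inl[OF assms] using xy
    by (auto simp: image_iff indicator_def)
qed

lemma attach_transfer_Inr:
  "att.transfer s W (Inr True) = (\<Sum>a\<in>out_arcs G y. wt s a * W (Inl a))"
  "att.transfer s W (Inr False) = (\<Sum>a\<in>out_arcs G x. wt s a * W (Inl a))"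
  unfolding att.transfer_def attach_succs_Inr by (simp_all add: sum.reindex)

lemma attach_strongly_connected:
  assumes "strongly_connected G" shows "strongly_connected (attach_edge G x y)"
proof (rule strongly_connectedI)
  show "verts (attach_edge G x y) \<noteq> {}" using x by (auto simp: attach_edge_def)
  fix u v assume "u \<in> verts (attach_edge G x y)" "v \<in> verts (attach_edge G x y)"
  then have "u \<in> verts G" "v \<in> verts G" by (auto simp: attach_edge_def)
  then have "u \<rightarrow>\<^sup>*\<^bsub>G\<^esub> v" using assms by (auto elim: strongly_connectedE)
  moreover have "arcs_ends G \<subseteq> arcs_ends (attach_edge G x y)"
    by (force simp: arcs_ends_def arc_to_ends_def attach_edge_def)
  ultimately show "u \<rightarrow>\<^sup>*\<^bsub>attach_edge G x y\<^esub> v"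
    unfolding reachable_def by (rule rtrancl_on_mono[rotated 2]) (auto simp: attach_edge_def)
qed

lemma attach_volume_entropy:
  assumes "strongly_connected G"
  shows "volume_entropy (attach_edge G x y) (attach_arev arev) (attach_len len l) = att.crit"
  by (rule att.volume_entropy_eq_crit[OF attach_strongly_connected[OF assms]])
     (auto simp: attach_edge_def)

lemma attach_entropy_le:
  assumes "strongly_connected G" "m \<le> min_len" "m \<le> l" "0 < s"
    "(card (arcs G) + 2) * exp (- s * m) \<le> 1/2"
  shows "0 \<le> volume_entropy (attach_edge G x y) (attach_arev arev) (attach_len len l)"
    "volume_entropy (attach_edge G x y) (attach_arev arev) (attach_len len l) \<le> s"
proof -
  have "m \<le> attach_len len l a" if "a \<in> arcs (attach_edge G x y)" for a
    using that min_len_le assms(2,3) by (fastforce simp: attach_edge_def attach_len_def)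
  moreover have "card (arcs (attach_edge G x y)) = card (arcs G) + 2"
    by (simp add: attach_edge_def card_Plus)
  ultimately have "att.convergent_at s"
    using assms by (intro att.convergent_at_large[of m]) auto
  then show "0 \<le> volume_entropy (attach_edge G x y) (attach_arev arev) (attach_len len l)"
    "volume_entropy (attach_edge G x y) (attach_arev arev) (attach_len len l) \<le> s"
    using att.crit_le[OF assms(4)] att.crit_nonneg attach_volume_entropy[OF assms(1)] by auto
qed

context
  fixes s :: real
  assumes s: "crit < s"
begin

text \<open>Consecutive crossings of the new edge in the same direction are joined by a walk between
  its ends, opposite ones by a loop. By symmetry both diagonal entries of the resulting matrix equal
  F = \<open>vgreen s (ind x) y\<close>, so its eigenvalues differ from F by a square root of the
  product of the two loop terms. The exponential is the weight of a crossing.\<close>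

definition edge_eigenvalue :: real where
  "edge_eigenvalue = exp (- s * l) * (vgreen s (ind x) y + sqrt (loop_green s x * loop_green s y))"

text \<open>
  The entries of \<open>edge_vec\<close> on the new arcs are the Perron eigenvector of the matrix
  \<open>((F y x, loop_green s y), (loop_green s x, F x y))\<close>, where \<open>F u v\<close> is \<open>vgreen s (ind v) u\<close> and thus
  symmetric. On the old arcs \<open>edge_vec\<close> is extended so that it is fixed by the transfer operator.
\<close>

definition edge_vec :: "'e + bool \<Rightarrow> real" where
  "edge_vec = case_sum (\<lambda>a. exp (- s * l) * (sqrt (loop_green s y) * green s (ind x) a + sqrt (loop_green s x) * green s (ind y) a))
     (\<lambda>b. if b then sqrt (loop_green s y) else sqrt (loop_green s x))"

lemma convergent_s: "convergent_at s"
  using convergent_above_crit[OF s] .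

text \<open>The source terms \<open>ind x\<close> and \<open>ind y\<close> in
  \<open>green_eq\<close> match the contributions of \<open>Inr True\<close>, entered at
  \<open>x\<close>, and of \<open>Inr False\<close>, entered at \<open>y\<close>.\<close>

lemma transfer_edge_vec_Inl:
  assumes "a \<in> arcs G" shows "att.transfer s edge_vec (Inl a) = edge_vec (Inl a)"
proof -
  have eq: "green s (ind v) a = ind v (head G a) + transfer s (green s (ind v)) a" for v
    using green_eq[OF convergent_s, of "ind v" a] assms by simp
  show ?thesis
    unfolding attach_transfer_Inl[OF assms]
    by (simp add: edge_vec_def transfer_cmult transfer_add eq algebra_simps)
qed

lemma transfer_edge_vec_Inr:
  assumes "0 < loop_green s x" "0 < loop_green s y"
  shows "att.transfer s edge_vec (Inr b) = edge_eigenvalue * edge_vec (Inr b)"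
proof -
  have out: "(\<Sum>a\<in>out_arcs G z. wt s a * edge_vec (Inl a)) = exp (- s * l) *
      (sqrt (loop_green s y) * (vgreen s (ind x) z - ind x z) + sqrt (loop_green s x) * (vgreen s (ind y) z - ind y z))" for z
    by (simp add: edge_vec_def vgreen_def sum_distrib_left sum.distrib[symmetric] algebra_simps)
  have sq: "loop_green s y = sqrt (loop_green s y) * sqrt (loop_green s y)" "loop_green s x = sqrt (loop_green s x) * sqrt (loop_green s x)"
    using assms by auto
  show ?thesis
  proof (cases b)
    case True
    have "att.transfer s edge_vec (Inr True)
        = exp (- s * l) * (sqrt (loop_green s y) * vgreen s (ind x) y + sqrt (loop_green s x) * loop_green s y)"
      unfolding attach_transfer_Inr out using xy by (simp add: loop_green_def)
    also have "sqrt (loop_green s x) * loop_green s y = sqrt (loop_green s x * loop_green s y) * sqrt (loop_green s y)"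
      by (subst sq(1)) (simp only: real_sqrt_mult mult_ac)
    finally show ?thesis using True by (simp add: edge_eigenvalue_def edge_vec_def algebra_simps)
  next
    case False
    have "att.transfer s edge_vec (Inr False)
        = exp (- s * l) * (sqrt (loop_green s y) * loop_green s x + sqrt (loop_green s x) * vgreen s (ind y) x)"
      unfolding attach_transfer_Inr out using xy by (simp add: loop_green_def)
    also have "sqrt (loop_green s y) * loop_green s x = sqrt (loop_green s x * loop_green s y) * sqrt (loop_green s x)"
      by (subst sq(2)) (simp only: real_sqrt_mult mult_ac)
    also have "vgreen s (ind y) x = vgreen s (ind x) y" by (rule vgreen_ind_commute[OF convergent_s])
    finally show ?thesis using False by (simp add: edge_eigenvalue_def edge_vec_def algebra_simps)
  qed
qed

lemma edge_vec_nonneg: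
  assumes "0 < loop_green s x" "0 < loop_green s y" "c \<in> arcs (attach_edge G x y)"
  shows "0 \<le> edge_vec c"
proof (cases c)
  case (Inl a)
  then have "a \<in> arcs G" using assms(3) by (auto simp: attach_edge_def)
  then have "0 \<le> green s (ind v) a" for v using convergent_s by (intro green_nonneg) auto
  then show ?thesis using assms(1,2) by (simp add: edge_vec_def Inl)
qed (use assms in \<open>simp add: edge_vec_def\<close>)

lemma attach_not_convergent:
  assumes "0 < loop_green s x" "0 < loop_green s y" "1 \<le> edge_eigenvalue"
  shows "\<not> att.convergent_at s"
proof (rule att.not_convergent_at)
  show "0 \<le> edge_vec c" if "c \<in> arcs (attach_edge G x y)" for c
    using edge_vec_nonneg[OF assms(1,2) that] .
  show "edge_vec c \<le> att.transfer s edge_vec c" if c: "c \<in> arcs (attach_edge G x y)" for c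
  proof (cases c)
    case (Inl a)
    then show ?thesis using c transfer_edge_vec_Inl[of a] by (auto simp: attach_edge_def)
  next
    case (Inr b)
    have "1 * edge_vec c \<le> edge_eigenvalue * edge_vec c" using assms(3) edge_vec_nonneg[OF assms(1,2) c] by (rule mult_right_mono)
    then show ?thesis using transfer_edge_vec_Inr[OF assms(1,2)] Inr by simp
  qed
  show "Inr True \<in> arcs (attach_edge G x y)" by (auto simp: attach_edge_def)
  show "0 < edge_vec (Inr True)" using assms(2) by (simp add: edge_vec_def)
qed

text \<open>On the old arcs \<open>green s (\<lambda>_. 1)\<close> accounts for the source and
  \<open>edge_vec\<close> is fixed. On the new arcs \<open>K * edge_vec\<close> exceeds its transfer
  by the factor \<open>1 - edge_eigenvalue\<close> times itself, which for large \<open>K\<close>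
  covers the vertex sum at the endpoint.\<close>

lemma attach_convergent:
  assumes "0 < loop_green s x" "0 < loop_green s y" "edge_eigenvalue < 1"
  shows "att.convergent_at s"
proof -
  define v where "v = (\<lambda>b::bool. if b then y else x)"
  define K where "K = (\<Sum>b\<in>UNIV. vgreen s (\<lambda>_. 1) (v b) / ((1 - edge_eigenvalue) * edge_vec (Inr b)))"
  have v: "v b \<in> verts G" for b using x y by (simp add: v_def)
  have uR: "0 < edge_vec (Inr b)" for b using assms by (simp add: edge_vec_def)
  have pos: "0 \<le> vgreen s (\<lambda>_. 1) (v b) / ((1 - edge_eigenvalue) * edge_vec (Inr b))" for b
    using vgreen_nonneg[OF convergent_s _ v, of "\<lambda>_. 1" b] uR[of b] assms(3)
    by (intro divide_nonneg_nonneg mult_nonneg_nonneg) auto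
  have K0: "0 \<le> K" unfolding K_def using pos by (intro sum_nonneg)
  have K: "vgreen s (\<lambda>_. 1) (v b) \<le> K * ((1 - edge_eigenvalue) * edge_vec (Inr b))" for b
  proof -
    have "vgreen s (\<lambda>_. 1) (v b) / ((1 - edge_eigenvalue) * edge_vec (Inr b)) \<le> K"
      unfolding K_def using pos by (intro member_le_sum) auto
    then show ?thesis using assms(3) uR[of b] by (simp add: divide_le_eq)
  qed
  define W where "W = (\<lambda>c. K * edge_vec c + case_sum (green s (\<lambda>_. 1)) (\<lambda>_. 0) c)"
  have "0 \<le> W c \<and> 1 + att.transfer s W c \<le> W c" if c: "c \<in> arcs (attach_edge G x y)" for c
  proof
    have TW: "att.transfer s W c = K * att.transfer s edge_vec c + att.transfer s (case_sum (green s (\<lambda>_. 1)) (\<lambda>_. 0)) c"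
      unfolding W_def by (simp only: att.transfer_add att.transfer_cmult)
    show "0 \<le> W c"
      using K0 edge_vec_nonneg[OF assms(1,2) c] c green_nonneg[OF convergent_s, of "\<lambda>_. 1"]
      by (auto simp: W_def attach_edge_def)
    show "1 + att.transfer s W c \<le> W c"
    proof (cases c)
      case (Inl a)
      then have a: "a \<in> arcs G" using c by (auto simp: attach_edge_def)
      have "att.transfer s (case_sum (green s (\<lambda>_. 1)) (\<lambda>_. 0)) (Inl a) = green s (\<lambda>_. 1) a - 1"
        unfolding attach_transfer_Inl[OF a] using green_eq[OF convergent_s, of "\<lambda>_. 1" a] a by simp
      then show ?thesis
        unfolding TW using a by (simp add: Inl W_def transfer_edge_vec_Inl)
    next
      case (Inr b)
      have "att.transfer s (case_sum (green s (\<lambda>_. 1)) (\<lambda>_. 0)) (Inr b) = vgreen s (\<lambda>_. 1) (v b) - 1"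
        by (cases b) (simp_all add: attach_transfer_Inr v_def vgreen_def)
      then show ?thesis
        unfolding TW using K[of b] by (simp add: Inr W_def transfer_edge_vec_Inr[OF assms(1,2)] algebra_simps)
    qed
  qed
  then show ?thesis unfolding att.convergent_at_def by blast
qed

end

lemma attach_entropy_bounds:
  assumes "strongly_connected G" "crit < s" "0 < loop_green s x" "0 < loop_green s y"
  shows "exp (- s * l) * (vgreen s (ind x) y + sqrt (loop_green s x * loop_green s y)) < 1 \<Longrightarrow>
      volume_entropy (attach_edge G x y) (attach_arev arev) (attach_len len l) \<le> s"
    and "1 \<le> exp (- s * l) * (vgreen s (ind x) y + sqrt (loop_green s x * loop_green s y)) \<Longrightarrow>
      s \<le> volume_entropy (attach_edge G x y) (attach_arev arev) (attach_len len l)"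
  using attach_convergent[OF assms(2-4)] attach_not_convergent[OF assms(2-4)] att.crit_le att.le_crit
    attach_volume_entropy[OF assms(1)] assms(2) crit_nonneg
  by (auto simp: edge_eigenvalue_def[OF assms(2)])

end

section \<open>Asymptotics of the eigenvalue and of the entropy\<close>

text \<open>The pole outweighs the 1 subtracted in \<open>loop_green\<close>, which keeps the loop
  terms positive near \<open>crit\<close>; their geometric mean then has a simple pole as
  well.\<close>

lemma loop_green_asymp:
  assumes "strongly_connected G" "0 < crit" "x \<in> verts G" "y \<in> verts G"
  obtains A M \<epsilon> where "0 < A" "0 < M" "0 < \<epsilon>"
    "\<And>s. crit < s \<Longrightarrow> s < crit + \<epsilon> \<Longrightarrow> 0 < loop_green s x \<and> 0 < loop_green s y \<and>
       \<bar>(s - crit) * (vgreen s (ind x) y + sqrt (loop_green s x * loop_green s y)) - A\<bar> \<le> M * (s - crit)"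
proof -
  have loop_green: "\<exists>B>0. \<exists>N>0. (\<forall>\<^sub>F s in at_right crit. \<bar>(s - crit) * loop_green s v - B\<bar> \<le> N * (s - crit))
      \<and> (\<forall>\<^sub>F s in at_right crit. B / 2 \<le> (s - crit) * loop_green s v \<and> (s - crit) * loop_green s v \<le> B + N)"
    if v: "v \<in> verts G" for v
  proof -
    obtain B N where B: "0 < B" "0 < N"
      "\<forall>\<^sub>F s in at_right crit. \<bar>(s - crit) * vgreen s (ind v) v - B\<bar> \<le> N * (s - crit)"
      using vgreen_ind_asymp[OF assms(1,2) v v] by blast
    have 1: "\<forall>\<^sub>F s in at_right crit. \<bar>(s - crit) * loop_green s v - B\<bar> \<le> (N + 1) * (s - crit)"
      using B(3) eventually_at_right_less
    proof eventually_elim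
      case (elim s)
      have "(s - crit) * loop_green s v = (s - crit) * vgreen s (ind v) v - (s - crit)"
        by (simp add: loop_green_def right_diff_distrib)
      then show ?case using elim by (simp add: distrib_right)
    qed
    have "\<forall>\<^sub>F s in at_right crit. crit < s \<and> s < crit + min 1 (B / (2 * (N + 1)))"
      using B by (intro eventually_at_right_crit) auto
    with 1 have "\<forall>\<^sub>F s in at_right crit. B / 2 \<le> (s - crit) * loop_green s v \<and> (s - crit) * loop_green s v \<le> B + (N + 1)"
    proof eventually_elim
      case (elim s)
      have "s - crit < B / (2 * (N + 1))" using elim(2) by linarith
      then have "(s - crit) * (2 * (N + 1)) < B" using B by (subst (asm) pos_less_divide_eq) auto
      then have "(N + 1) * (s - crit) < B / 2" by (simp add: algebra_simps)
      moreover have "(N + 1) * (s - crit) \<le> (N + 1) * 1"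
        using elim(2) B by (intro mult_left_mono) auto
      ultimately show ?case using elim(1) by (simp add: abs_le_iff)
    qed
    with 1 B show ?thesis by (intro exI[of _ B] exI[of _ "N + 1"] conjI) auto
  qed
  obtain B N where B: "0 < B" "0 < N"
    "\<forall>\<^sub>F s in at_right crit. \<bar>(s - crit) * loop_green s x - B\<bar> \<le> N * (s - crit)"
    "\<forall>\<^sub>F s in at_right crit. B / 2 \<le> (s - crit) * loop_green s x \<and> (s - crit) * loop_green s x \<le> B + N"
    using loop_green[OF assms(3)] by blast
  obtain B' N' where B': "0 < B'" "0 < N'"
    "\<forall>\<^sub>F s in at_right crit. \<bar>(s - crit) * loop_green s y - B'\<bar> \<le> N' * (s - crit)"
    "\<forall>\<^sub>F s in at_right crit. B' / 2 \<le> (s - crit) * loop_green s y \<and> (s - crit) * loop_green s y \<le> B' + N'"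
    using loop_green[OF assms(4)] by blast
  obtain A M where A: "0 < A" "0 < M"
    "\<forall>\<^sub>F s in at_right crit. \<bar>(s - crit) * vgreen s (ind x) y - A\<bar> \<le> M * (s - crit)"
    using vgreen_ind_asymp[OF assms(1,2,4,3)] by blast
  define R where "R = sqrt (B * B')"
  have R: "0 < R" using B B' by (simp add: R_def)
  \<comment> \<open>The difference of \<open>sqrt (X * Y)\<close> and \<open>R\<close> is that of
    the squares divided by \<open>sqrt (X * Y) + R\<close>, which is at least \<open>R\<close>. The
    numerator collects the errors \<open>N\<close> and \<open>N'\<close> of the two factors.\<close>
  define L where "L = ((B + N) * N' + B' * N) / R"
  have L: "0 < L" unfolding L_def using R B B' by (intro divide_pos_pos add_pos_pos mult_pos_pos) auto
  have "\<forall>\<^sub>F s in at_right crit. 0 < loop_green s x \<and> 0 < loop_green s y \<and>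
       \<bar>(s - crit) * (vgreen s (ind x) y + sqrt (loop_green s x * loop_green s y)) - (A + R)\<bar> \<le> (M + L) * (s - crit)"
    using A(3) B(3,4) B'(3,4) eventually_at_right_less
  proof eventually_elim
    case (elim s)
    define e where "e = s - crit"
    define X where "X = e * loop_green s x"
    define Y where "Y = e * loop_green s y"
    have e: "0 < e" using elim by (simp add: e_def)
    have X: "\<bar>X - B\<bar> \<le> N * e" "0 < X" "X \<le> B + N" and Y: "\<bar>Y - B'\<bar> \<le> N' * e" "0 < Y"
      using elim B B' by (auto simp: X_def Y_def e_def)
    have pos: "0 < loop_green s x" "0 < loop_green s y"
      using X(2) Y(2) e by (auto simp: X_def Y_def zero_less_mult_iff)
    have "\<bar>X * Y - B * B'\<bar> = \<bar>X * (Y - B') + B' * (X - B)\<bar>" by (simp add: algebra_simps)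
    also have "\<dots> \<le> \<bar>X\<bar> * \<bar>Y - B'\<bar> + \<bar>B'\<bar> * \<bar>X - B\<bar>"
      by (metis abs_mult abs_triangle_ineq)
    also have "\<dots> \<le> (B + N) * (N' * e) + B' * (N * e)"
      using X Y B B' by (intro add_mono mult_mono) auto
    also have "\<dots> = ((B + N) * N' + B' * N) * e" by (simp add: algebra_simps)
    also have "\<dots> = L * R * e" using R by (simp add: L_def)
    finally have XY: "\<bar>X * Y - B * B'\<bar> \<le> L * R * e" .
    have "(sqrt (X * Y) - R) * (sqrt (X * Y) + R) = X * Y - B * B'"
      using X Y B B' by (simp add: R_def algebra_simps)
    then have "\<bar>sqrt (X * Y) - R\<bar> * (sqrt (X * Y) + R) \<le> L * R * e"
      using XY R X Y by (metis abs_mult abs_of_pos add_nonneg_pos mult_nonneg_nonneg less_imp_le real_sqrt_ge_zero)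
    moreover have "\<bar>sqrt (X * Y) - R\<bar> * R \<le> \<bar>sqrt (X * Y) - R\<bar> * (sqrt (X * Y) + R)"
      using X Y by (intro mult_left_mono) auto
    ultimately have "\<bar>sqrt (X * Y) - R\<bar> * R \<le> L * e * R" by (simp add: mult_ac)
    then have sq: "\<bar>sqrt (X * Y) - R\<bar> \<le> L * e" using R by simp
    have "sqrt (X * Y) = e * sqrt (loop_green s x * loop_green s y)"
      using e by (simp add: X_def Y_def real_sqrt_mult mult_ac)
    then have "e * (vgreen s (ind x) y + sqrt (loop_green s x * loop_green s y)) - (A + R)
        = (e * vgreen s (ind x) y - A) + (sqrt (X * Y) - R)"
      by (simp add: algebra_simps)
    also have "\<bar>\<dots>\<bar> \<le> M * e + L * e"
      using sq elim(1) by (simp add: e_def abs_le_iff)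
    finally show ?case using pos by (simp add: e_def algebra_simps)
  qed
  then obtain b where "crit < b" and b: "\<And>s. crit < s \<Longrightarrow> s < b \<Longrightarrow> 0 < loop_green s x \<and> 0 < loop_green s y \<and>
       \<bar>(s - crit) * (vgreen s (ind x) y + sqrt (loop_green s x * loop_green s y)) - (A + R)\<bar> \<le> (M + L) * (s - crit)"
    unfolding eventually_at_right_field by blast
  show ?thesis
    by (rule that[of "A + R" "M + L" "b - crit"]) (use A R L \<open>crit < b\<close> b in auto)
qed

lemma attach_edge_asymptotics:
  assumes "strongly_connected G" "arcs G \<noteq> {}" "x \<in> verts G" "y \<in> verts G" "x \<noteq> y"
  defines "h \<equiv> volume_entropy G arev len"
    and "h' \<equiv> \<lambda>l. volume_entropy (attach_edge G x y) (attach_arev arev) (attach_len len l)"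
  shows "\<exists>C>0. \<forall>\<gamma><1.
    (\<lambda>l. h' l - (h + C * exp (- h * l))) \<in> O[at_top](\<lambda>l. exp (- (1 + \<gamma>) * h * l))"
proof (cases "crit = 0")
  case True
  then have h: "h = 0" using volume_entropy_eq_crit[OF assms(1,2)] by (simp add: h_def)
  define m where "m = min min_len 1"
  have m: "0 < m" "m \<le> min_len" "m \<le> 1" using min_len_pos by (auto simp: m_def)
  obtain s where s: "0 < s" "(card (arcs G) + 2) * exp (- s * m) \<le> 1/2"
    using ex_exp_small[OF m(1), of "real (card (arcs G) + 2)"] by auto
  \<comment> \<open>For \<open>h = 0\<close> all these exponentials equal 1; the choice of 1 as the
    constant is arbitrary.\<close>
  have "\<forall>\<^sub>F l in at_top. norm (h' l - (h + 1 * exp (- h * l))) \<le> (s + 1) * norm (exp (- (1 + \<gamma>) * h * l))" for \<gamma>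
    using eventually_ge_at_top[of 1]
  proof eventually_elim
    case (elim l)
    have "0 \<le> h' l" "h' l \<le> s"
      unfolding h'_def using attach_entropy_le[OF assms(3-5) _ assms(1) m(2) _ s] elim m by auto
    then show ?case by (simp add: h)
  qed
  then show ?thesis
    by (intro exI[of _ 1] conjI allI impI) (auto intro: bigoI simp only: zero_less_one)
next
  case False
  then have pos: "0 < crit" using crit_nonneg by simp
  have h: "h = crit" using volume_entropy_eq_crit[OF assms(1,2)] by (simp add: h_def)
  obtain A M \<epsilon> where A: "0 < A" "0 < M" "0 < \<epsilon>"
    "\<And>s. crit < s \<Longrightarrow> s < crit + \<epsilon> \<Longrightarrow> 0 < loop_green s x \<and> 0 < loop_green s y \<and>
       \<bar>(s - crit) * (vgreen s (ind x) y + sqrt (loop_green s x * loop_green s y)) - A\<bar> \<le> M * (s - crit)"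
    using loop_green_asymp[OF assms(1) pos assms(3,4)] by metis
  have "\<exists>K. \<forall>\<^sub>F l in at_top. \<bar>h' l - (h + A * exp (- h * l))\<bar> \<le> K * (l * exp (- h * l) * exp (- h * l))"
    unfolding h
  proof (rule asymptotic_root[OF pos A(1-3), where \<rho> = "\<lambda>s. vgreen s (ind x) y + sqrt (loop_green s x * loop_green s y)"])
    fix l s :: real
    assume *: "0 < l" "crit < s" "s < crit + \<epsilon>"
    have bounds: "0 < loop_green s x" "0 < loop_green s y" using A(4) * by auto
    show "h' l \<le> s" if "exp (- s * l) * (vgreen s (ind x) y + sqrt (loop_green s x * loop_green s y)) < 1"
      unfolding h'_def using attach_entropy_bounds(1)[OF assms(3-5) *(1) assms(1) *(2) bounds that] .
    show "s \<le> h' l" if "1 \<le> exp (- s * l) * (vgreen s (ind x) y + sqrt (loop_green s x * loop_green s y))"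
      unfolding h'_def using attach_entropy_bounds(2)[OF assms(3-5) *(1) assms(1) *(2) bounds that] .
  qed (use A(4) in auto)
  then obtain K where K:
    "\<forall>\<^sub>F l in at_top. \<bar>h' l - (h + A * exp (- h * l))\<bar> \<le> K * (l * exp (- h * l) * exp (- h * l))"
    by blast
  have "(\<lambda>l. h' l - (h + A * exp (- h * l))) \<in> O[at_top](\<lambda>l. exp (- (1 + \<gamma>) * h * l))" if "\<gamma> < 1" for \<gamma>
  proof (rule bigoI)
    \<comment> \<open>The surplus in \<open>2 * h = c + (1 + \<gamma>) * h\<close> absorbs the
      factor \<open>l\<close>, because \<open>l * exp (- c * l) \<le> 1 / c\<close>. Its positivity
      is where \<open>\<gamma> < 1\<close> enters.\<close>
    define c where "c = (1 - \<gamma>) * h"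
    have c: "0 < c" using that pos by (simp add: c_def h)
    show "\<forall>\<^sub>F l in at_top. norm (h' l - (h + A * exp (- h * l)))
        \<le> \<bar>K\<bar> / c * norm (exp (- (1 + \<gamma>) * h * l))"
      using K eventually_ge_at_top[of 0]
    proof eventually_elim
      case (elim l)
      have "c * l \<le> exp (c * l)" using exp_ge_add_one_self[of "c * l"] by linarith
      then have "l * exp (- c * l) \<le> 1 / c" using c by (simp add: exp_minus field_simps)
      then have "l * exp (- c * l) * exp (- (1 + \<gamma>) * h * l) \<le> 1 / c * exp (- (1 + \<gamma>) * h * l)"
        by (rule mult_right_mono) simp
      moreover have "l * exp (- c * l) * exp (- (1 + \<gamma>) * h * l) = l * exp (- h * l) * exp (- h * l)"
        by (simp add: c_def mult.assoc exp_add[symmetric] algebra_simps)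
      ultimately have le: "l * exp (- h * l) * exp (- h * l) \<le> 1 / c * exp (- (1 + \<gamma>) * h * l)"
        by (simp only:)
      have "\<bar>h' l - (h + A * exp (- h * l))\<bar> \<le> \<bar>K\<bar> * (l * exp (- h * l) * exp (- h * l))"
        using elim by (auto intro: order_trans[OF _ mult_right_mono])
      also have "\<dots> \<le> \<bar>K\<bar> * (1 / c * exp (- (1 + \<gamma>) * h * l))"
        using le by (rule mult_left_mono) simp
      finally show ?case by simp
    qed
  qed
  then show ?thesis using A(1) by blast
qed

end

theorem theorem1p2:
  fixes G :: "('v, 'e) pre_digraph" and arev :: "'e \<Rightarrow> 'e" and len :: "'e \<Rightarrow> real"
    and x y :: 'v and c\<^sub>1 c\<^sub>2 :: "'e awalk" and h :: real and h' :: "real \<Rightarrow> real"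
  assumes "finite_metric_graph G arev len"
    and "strongly_connected G"
    and "is_cycle G arev c\<^sub>1" and "is_cycle G arev c\<^sub>2"
    and "diophantine (path_length len c\<^sub>1 / path_length len c\<^sub>2)"
    and "x \<in> verts G" and "y \<in> verts G" and "x \<noteq> y" and "(x, y) \<notin> arcs_ends G"
  defines "h \<equiv> volume_entropy G arev len"
    and "h' \<equiv> \<lambda>l. volume_entropy (attach_edge G x y) (attach_arev arev) (attach_len len l)"
  shows "\<exists>C>0. \<forall>\<gamma><1.
    (\<lambda>l. h' l - (h + C * exp (- h * l))) \<in> O[at_top](\<lambda>l. exp (- (1 + \<gamma>) * h * l))"
proof -
  interpret finite_metric_graph G arev len by fact
  obtain u where "awalk u c\<^sub>1 u" "c\<^sub>1 \<noteq> []" using assms(3) by (auto simp: is_cycle_def)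
  then have "arcs G \<noteq> {}" by (cases c\<^sub>1) (auto simp: awalk_Cons_iff)
  then show ?thesis
    unfolding h_def h'_def by (intro attach_edge_asymptotics assms(2,6-8))
qed

end
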